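(* Let $n\ge 7$ and $3\le k\le n-3$, and let $H$ be a strong $k$-tournament on $n$ vertices. Then there is a strong tournament $T\in\mathcal{T}_H$.
   Context: For $2\le k\le n$, a $k$-tournament $H$ on $n$ vertices is a pair $(V,A)$ where $V$ is a set of $n$ vertices and $A$ is a set of $k$-tuples of distinct vertices (hyperarcs) such that for every $k$-subset $S\subseteq V$, $A$ contains exactly one of the $k!$ orderings of $S$. For a hyperarc $a=(x_1\dots x_k)$, $x_i$ precedes $x_j$ in $a$ if $i<j$. A path in $H$ is an alternating sequence $x_1a_1x_2\dots x_ma_mx_{m+1}$ of distinct vertices and distinct hyperarcs with $x_i$ preceding $x_{i+1}$ in $a_i$; $H$ is strong if for every ordered pair $(u,v)$ of distinct vertices there is a path from $u$ to $v$. A tournament is a $2$-tournament, i.e. an orientation of the complete graph; it is strong if it is strongly connected. For a tournament $T$ with $V(T)=V(H)$, an arc $(u,v)$ of $T$ is generated by a hyperarc $a$ of $H$ if $u,v$ both lie in $a$ and $u$ precedes $v$ in $a$. $T$ is generated by $H$ if each arc of $T$ is generated by a hyperarc of $H$ assigned to it, with distinct arcs assigned distinct hyperarcs. $\mathcal{T}_H$ is the set of all tournaments generated by $H$. *)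

theory Defs
  imports Main
begin

text \<open>A hyperarc is a list of distinct vertices; x precedes y in a if x occurs
  at an earlier position than y.\<close>
definition precedes :: "'a \<Rightarrow> 'a \<Rightarrow> 'a list \<Rightarrow> bool" where
  "precedes x y a \<longleftrightarrow> (\<exists>i j. i < j \<and> j < length a \<and> a ! i = x \<and> a ! j = y)"

definition k_tournament :: "'a set \<Rightarrow> 'a list set \<Rightarrow> nat \<Rightarrow> bool" where
  "k_tournament V A k \<longleftrightarrow>
     finite V \<and> 2 \<le> k \<and> k \<le> card V \<and>
     (\<forall>a\<in>A. distinct a \<and> length a = k \<and> set a \<subseteq> V) \<and>
     (\<forall>S. S \<subseteq> V \<and> card S = k \<longrightarrow> (\<exists>!a. a \<in> A \<and> set a = S))"

definition hpath :: "'a list set \<Rightarrow> 'a list \<Rightarrow> 'a list list \<Rightarrow> 'a \<Rightarrow> 'a \<Rightarrow> bool" where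
  "hpath A xs as u v \<longleftrightarrow>
     xs \<noteq> [] \<and> length as + 1 = length xs \<and> distinct xs \<and> distinct as \<and>
     hd xs = u \<and> last xs = v \<and>
     (\<forall>i < length as. as ! i \<in> A \<and> precedes (xs ! i) (xs ! Suc i) (as ! i))"

definition strong_hyper :: "'a set \<Rightarrow> 'a list set \<Rightarrow> bool" where
  "strong_hyper V A \<longleftrightarrow>
     (\<forall>u\<in>V. \<forall>v\<in>V. u \<noteq> v \<longrightarrow> (\<exists>xs as. hpath A xs as u v))"

definition tournament :: "'a set \<Rightarrow> ('a \<times> 'a) set \<Rightarrow> bool" where
  "tournament V T \<longleftrightarrow> T \<subseteq> V \<times> V \<and> (\<forall>x. (x, x) \<notin> T) \<and>
     (\<forall>u\<in>V. \<forall>v\<in>V. u \<noteq> v \<longrightarrow> ((u, v) \<in> T \<longleftrightarrow> (v, u) \<notin> T))"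

definition strong_tournament :: "'a set \<Rightarrow> ('a \<times> 'a) set \<Rightarrow> bool" where
  "strong_tournament V T \<longleftrightarrow> tournament V T \<and>
     (\<forall>u\<in>V. \<forall>v\<in>V. u \<noteq> v \<longrightarrow> (u, v) \<in> T\<^sup>+)"

definition generated_by :: "'a list set \<Rightarrow> ('a \<times> 'a) set \<Rightarrow> bool" where
  "generated_by A T \<longleftrightarrow>
     (\<exists>f. inj_on f T \<and> (\<forall>(u, v)\<in>T. f (u, v) \<in> A \<and> precedes u v (f (u, v))))"

definition gen_tournaments :: "'a set \<Rightarrow> 'a list set \<Rightarrow> ('a \<times> 'a) set set" where
  "gen_tournaments V A = {T. tournament V T \<and> generated_by A T}"

end

theory Submission
  imports Defs "HOL.Binomial_Plus"
begin

text \<open>Let N be the number of hyperarcs containing a given pair, and call an arc strong if at least t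
  of them generate it, where 2 t is at most N + 1, so that the strong arcs form a semicomplete digraph. Some vertex z is reached
  from every vertex and some vertex s reaches every vertex along strong arcs. Adding the arcs of a path of H
  from z to s, which comes with distinct hyperarcs, makes this digraph strong, so by Camion's theorem it has
  a Hamiltonian cycle. The strong arcs of the cycle are assigned hyperarcs by Hall's theorem. This is direct
  if N is large compared with n; for k = 3 each strong arc has a triple that no other arc of the cycle can
  use; only n = 7, k = 4 needs the cycle to be changed. Finally Hall's theorem assigns the unused hyperarcs
  to the remaining pairs, whose orientation is irrelevant since the cycle already makes T strong.\<close>

section \<open>Systems of distinct representatives\<close>

text \<open>A cycle arc that is not strong must lie on the path and keeps the hyperarc it has there,
  so Hall's theorem only has to serve the strong arcs, after these hyperarcs are deleted. This
  decides the threshold. If \<open>N\<close> is at least \<open>2 * n - 1\<close>, then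
  \<open>t = n\<close> lets a single strong arc survive the deletion of all other values. If
  \<open>k = 3\<close>, two triples on an arc may be contested, so \<open>t = 3\<close>. For
  \<open>n = 7\<close>, \<open>k = 4\<close> there are \<open>N = 10\<close> hyperarcs on a pair and
  \<open>t\<close> is at most 5; five weak arcs can then use up every hyperarc generating a strong
  one. The way out is that an arc with at most 4 generating hyperarcs has at least 6 in the opposite
  direction, so the reversed cycle is a second candidate; what still resists is repaired by
  exchanging two consecutive vertices or by moving one of them elsewhere in the reversed cycle. The
  pairs off the cycle are kept unordered, so that all \<open>N\<close> hyperarcs through a pair are
  candidates and the second use of Hall's theorem becomes pure counting.\<close>

definition sdr :: "('i \<Rightarrow> 'b set) \<Rightarrow> 'i set \<Rightarrow> bool" where
  "sdr F I \<longleftrightarrow> (\<exists>f. inj_on f I \<and> (\<forall>i\<in>I. f i \<in> F i))"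

text \<open>On \<open>I \<inter> J\<close> the values of \<open>f\<close> win, so clashes matter
  only on \<open>J - I\<close> and callers may let the two families overlap.\<close>

lemma sdr_Un:
  assumes f: "inj_on f I" "\<And>i. i \<in> I \<Longrightarrow> f i \<in> F i"
    and g: "inj_on g J" "\<And>j. j \<in> J \<Longrightarrow> g j \<in> F j"
    and disj: "\<And>i j. i \<in> I \<Longrightarrow> j \<in> J - I \<Longrightarrow> f i \<noteq> g j"
  shows "sdr F (I \<union> J)"
  unfolding sdr_def
proof (intro exI conjI)
  let ?h = "\<lambda>i. if i \<in> I then f i else g i"
  show "inj_on ?h (I \<union> J)"
  proof (rule inj_onI)
    fix a b assume "a \<in> I \<union> J" "b \<in> I \<union> J" and eq: "?h a = ?h b"
    then consider "a \<in> I" "b \<in> I" | "a \<in> I" "b \<in> J - I" | "a \<in> J - I" "b \<in> I"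
      | "a \<in> J - I" "b \<in> J - I" by blast
    then show "a = b"
    proof cases
      case 1 then show ?thesis using eq f(1) by (auto dest: inj_onD)
    next
      case 2 then show ?thesis using eq disj[of a b] by auto
    next
      case 3 then show ?thesis using eq disj[of b a] by auto
    next
      case 4 then show ?thesis using eq g(1) by (auto dest: inj_onD)
    qed
  qed
  show "\<forall>i\<in>I \<union> J. ?h i \<in> F i" using f(2) g(2) by auto
qed

text \<open>The Halmos-Vaughan induction. A tight proper subfamily \<open>S\<close> is matched
  inside its union \<open>U\<close>, and the other indices avoid \<open>U\<close>: the condition for
  \<open>R \<union> S\<close> minus the tight count for \<open>S\<close> gives it for
  \<open>R\<close>. If no \<open>S\<close> is tight, every proper nonempty subfamily has a spare
  value, so \<open>i\<close> may take any \<open>y\<close>.\<close>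

theorem Hall:
  fixes F :: "'i \<Rightarrow> 'b set"
  assumes "finite I" "\<And>i. i \<in> I \<Longrightarrow> finite (F i)"
    and "\<And>S. S \<subseteq> I \<Longrightarrow> card S \<le> card (\<Union>(F ` S))"
  shows "sdr F I"
  using assms
proof (induction "card I" arbitrary: I F rule: less_induct)
  case less
  note fin = less.prems(1) and finF = less.prems(2) and hall = less.prems(3)
  show ?case
  proof (cases "I = {}")
    case True
    then show ?thesis by (simp add: sdr_def)
  next
    case False
    then obtain i where i: "i \<in> I" by blast
    show ?thesis
    proof (cases "\<exists>S. S \<subset> I \<and> S \<noteq> {} \<and> card (\<Union>(F ` S)) \<le> card S")
      case True
      then obtain S where S: "S \<subset> I" "S \<noteq> {}" "card (\<Union>(F ` S)) \<le> card S" by blast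
      have finS: "finite S" using S fin by (meson finite_subset psubset_imp_subset)
      have ltS: "card S < card I" using S fin by (simp add: psubset_card_mono)
      have "sdr F S"
      proof (rule less.hyps[OF ltS finS])
        show "\<And>i. i \<in> S \<Longrightarrow> finite (F i)" using finF S(1) by auto
        show "\<And>R. R \<subseteq> S \<Longrightarrow> card R \<le> card (\<Union>(F ` R))" using hall S(1) by auto
      qed
      then obtain f where f: "inj_on f S" "\<And>i. i \<in> S \<Longrightarrow> f i \<in> F i" unfolding sdr_def by blast
      define U where "U = \<Union>(F ` S)"
      have finU: "finite U" unfolding U_def using finS finF S by auto
      have "card (I - S) < card I"
        using S fin by (intro psubset_card_mono) auto
      moreover have "card R \<le> card (\<Union>((\<lambda>j. F j - U) ` R))" if R: "R \<subseteq> I - S" for R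
      proof -
        have finR: "finite R" using R fin by (meson finite_Diff finite_subset)
        have "card R + card S = card (R \<union> S)"
          using R finR finS by (subst card_Un_disjoint) auto
        also have "\<dots> \<le> card (\<Union>(F ` (R \<union> S)))" using hall[of "R \<union> S"] R S by auto
        also have "\<Union>(F ` (R \<union> S)) = \<Union>((\<lambda>j. F j - U) ` R) \<union> U" unfolding U_def by auto
        also have "card \<dots> \<le> card (\<Union>((\<lambda>j. F j - U) ` R)) + card U" by (rule card_Un_le)
        finally show ?thesis using S(3) unfolding U_def by simp
      qed
      ultimately have "sdr (\<lambda>j. F j - U) (I - S)"
        using fin finF by (intro less.hyps) auto
      then obtain g where g: "inj_on g (I - S)" "\<And>j. j \<in> I - S \<Longrightarrow> g j \<in> F j - U"
        unfolding sdr_def by blast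
      have "sdr F (S \<union> (I - S))"
      proof (rule sdr_Un[OF f g(1)])
        show "\<And>j. j \<in> I - S \<Longrightarrow> g j \<in> F j" using g(2) by blast
        show "\<And>i j. i \<in> S \<Longrightarrow> j \<in> I - S - S \<Longrightarrow> f i \<noteq> g j"
          using f(2) g(2) unfolding U_def by fastforce
      qed
      then show ?thesis using S(1) by (simp add: Un_absorb1 psubset_imp_subset)
    next
      case False
      then have strict: "\<And>S. S \<subset> I \<Longrightarrow> S \<noteq> {} \<Longrightarrow> card S < card (\<Union>(F ` S))"
        by (meson not_le)
      have "card {i} \<le> card (\<Union>(F ` {i}))" using hall[of "{i}"] i by blast
      then obtain y where y: "y \<in> F i" by fastforce
      have "card (I - {i}) < card I" using i fin by (intro psubset_card_mono) auto
      moreover have "card R \<le> card (\<Union>((\<lambda>j. F j - {y}) ` R))" if R: "R \<subseteq> I - {i}" for R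
      proof (cases "R = {}")
        case False
        have "card R < card (\<Union>(F ` R))" using strict[of R] R i False by auto
        moreover have "\<Union>((\<lambda>j. F j - {y}) ` R) = \<Union>(F ` R) - {y}" by auto
        ultimately show ?thesis by (auto simp: card_Diff_singleton_if)
      qed simp
      ultimately have "sdr (\<lambda>j. F j - {y}) (I - {i})"
        using fin finF by (intro less.hyps) auto
      then obtain g where g: "inj_on g (I - {i})" "\<And>j. j \<in> I - {i} \<Longrightarrow> g j \<in> F j - {y}"
        unfolding sdr_def by blast
      have "sdr F ({i} \<union> (I - {i}))"
        by (rule sdr_Un[where f = "\<lambda>_. y" and g = g]) (use g y in auto)
      then show ?thesis using i by (simp add: insert_absorb)
    qed
  qed
qed

text \<open>Prescribed values on \<open>W\<close> stay fixed, as needed for path arcs that come with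
  hyperarcs; Hall's theorem is applied to what they leave.\<close>

lemma Hall_extend:
  assumes f: "inj_on f W" "\<And>i. i \<in> W \<Longrightarrow> f i \<in> F i"
    and M: "finite M" "\<And>i. i \<in> M \<Longrightarrow> finite (F i)"
    and hall: "\<And>S. S \<subseteq> M \<Longrightarrow> card S \<le> card (\<Union>(F ` S) - f ` W)"
  shows "sdr F (W \<union> M)"
proof -
  have "\<And>S. \<Union>((\<lambda>i. F i - f ` W) ` S) = \<Union>(F ` S) - f ` W" by auto
  then have "sdr (\<lambda>i. F i - f ` W) M"
    using M hall by (intro Hall) auto
  then obtain g where g: "inj_on g M" "\<forall>j\<in>M. g j \<in> F j - f ` W"
    unfolding sdr_def by blast
  show ?thesis
  proof (rule sdr_Un[OF f g(1)])
    show "f i \<noteq> g j" if "i \<in> W" "j \<in> M - W" for i j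
      using that g(2) by force
  qed (use g(2) in auto)
qed

text \<open>Transports an assignment along a renaming of arcs; used for exchanging two vertices and
  for reversing a cycle.\<close>

lemma sdr_image:
  assumes "inj_on t I" "sdr (\<lambda>i. F (t i)) I"
  shows "sdr F (t ` I)"
proof -
  obtain f where f: "inj_on f I" "\<forall>i\<in>I. f i \<in> F (t i)" using assms(2) unfolding sdr_def by blast
  have "inj_on (f \<circ> inv_into I t) (t ` I)"
    using f(1) inj_on_inv_into[of "t ` I" t I] inv_into_into[of _ t I]
    by (intro comp_inj_on inj_on_subset[OF f(1)]) auto
  moreover have "\<forall>j\<in>t ` I. (f \<circ> inv_into I t) j \<in> F j"
    using f(2) assms(1) by auto
  ultimately show ?thesis unfolding sdr_def by blast
qed

lemma ex_mem_notin: "finite Y \<Longrightarrow> card Y < card X \<Longrightarrow> \<exists>a\<in>X. a \<notin> Y"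
  by (meson card_mono leD subsetI)

lemma sdr_Un_pair:
  assumes f: "inj_on f W" "\<And>i. i \<in> W \<Longrightarrow> f i \<in> F i"
    and "a \<in> F i" "b \<in> F j" "a \<noteq> b" "a \<notin> f ` W" "b \<notin> f ` W"
  shows "sdr F (W \<union> {i, j})"
  by (rule sdr_Un[OF f, of "\<lambda>x. if x = i then a else b"]) (use assms in \<open>auto simp: inj_on_def\<close>)

lemma sdr_pair: "a \<in> F i \<Longrightarrow> b \<in> F j \<Longrightarrow> a \<noteq> b \<Longrightarrow> sdr F {i, j}"
  using sdr_Un_pair[of "\<lambda>_. a" "{}" F a i b j] by simp

section \<open>Hamiltonian cycles\<close>

text \<open>A loop counts as the cycle on a single vertex, the starting point for insertions.\<close>

definition ham_cycle :: "'a set \<Rightarrow> ('a \<times> 'a) set \<Rightarrow> bool" where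
  "ham_cycle V h \<longleftrightarrow> h \<subseteq> V \<times> V \<and> (\<forall>x\<in>V. \<exists>!y. (x, y) \<in> h) \<and> (\<forall>y\<in>V. \<exists>!x. (x, y) \<in> h)
     \<and> (\<forall>x\<in>V. \<forall>y\<in>V. (x, y) \<in> h\<^sup>+)"

lemma ham_cycleI:
  assumes "\<And>x y. x \<in> V \<Longrightarrow> y \<in> V \<Longrightarrow> (x, y) \<in> h\<^sup>+" and "h \<subseteq> V \<times> V"
    and "\<And>x. x \<in> V \<Longrightarrow> \<exists>!y. (x, y) \<in> h" and "\<And>y. y \<in> V \<Longrightarrow> \<exists>!x. (x, y) \<in> h"
  shows "ham_cycle V h"
  using assms by (simp add: ham_cycle_def)

lemma ham_cycle_subset: "ham_cycle V h \<Longrightarrow> h \<subseteq> V \<times> V"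
  and ham_cycle_succ: "ham_cycle V h \<Longrightarrow> x \<in> V \<Longrightarrow> \<exists>y. (x, y) \<in> h"
  and ham_cycle_pred: "ham_cycle V h \<Longrightarrow> x \<in> V \<Longrightarrow> \<exists>y. (y, x) \<in> h"
  and ham_cycle_succ_unique: "ham_cycle V h \<Longrightarrow> (x, y) \<in> h \<Longrightarrow> (x, z) \<in> h \<Longrightarrow> y = z"
  and ham_cycle_pred_unique: "ham_cycle V h \<Longrightarrow> (x, z) \<in> h \<Longrightarrow> (y, z) \<in> h \<Longrightarrow> x = y"
  and ham_cycle_trancl: "ham_cycle V h \<Longrightarrow> x \<in> V \<Longrightarrow> y \<in> V \<Longrightarrow> (x, y) \<in> h\<^sup>+"
  unfolding ham_cycle_def by blast+

section \<open>Operations on Hamiltonian cycles\<close>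

lemma ham_cycle_converse: "ham_cycle V h \<Longrightarrow> ham_cycle V (h\<inverse>)"
  unfolding ham_cycle_def by (auto simp: trancl_converse)

text \<open>Serves as induction along the cycle: a property passed on to successors spreads from one
  vertex to all.\<close>

lemma ham_cycle_closed:
  assumes h: "ham_cycle V h" and X: "X \<noteq> {}" "X \<subseteq> V" "\<And>x y. x \<in> X \<Longrightarrow> (x, y) \<in> h \<Longrightarrow> y \<in> X"
  shows "X = V"
proof -
  obtain x where x: "x \<in> X" using X by blast
  have "y \<in> X" if "(x, y) \<in> h\<^sup>+" for y
    using that by (induction rule: trancl_induct) (use x X(3) in auto)
  then show ?thesis using ham_cycle_trancl[OF h] x X(2) by blast
qed

lemma ham_cycle_insert:
  assumes h: "ham_cycle V h" and xy: "(x, y) \<in> h" and v: "v \<notin> V"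
  shows "ham_cycle (insert v V) (h - {(x, y)} \<union> {(x, v), (v, y)})"
proof -
  let ?h = "h - {(x, y)} \<union> {(x, v), (v, y)}"
  note sub = ham_cycle_subset[OF h]
  have xyV: "x \<in> V" "y \<in> V" using sub xy by auto
  have xv: "(x, v) \<in> ?h\<^sup>+" "(v, y) \<in> ?h\<^sup>+" by auto
  have step: "(a, b) \<in> ?h\<^sup>+" if "(a, b) \<in> h" for a b
  proof (cases "(a, b) = (x, y)")
    case True
    then show ?thesis using xv by auto
  next
    case False
    then show ?thesis using that by auto
  qed
  have "(a, b) \<in> ?h\<^sup>+" if "(a, b) \<in> h\<^sup>+" for a b
    using that by (induction rule: trancl_induct) (use step in \<open>auto intro: trancl_trans\<close>)
  then have reach: "(a, b) \<in> ?h\<^sup>+" if "a \<in> V" "b \<in> V" for a b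
    using ham_cycle_trancl[OF h] that by blast
  have "(a, b) \<in> ?h\<^sup>+" if "a \<in> insert v V" "b \<in> insert v V" for a b
  proof -
    have 1: "(a, x) \<in> ?h\<^sup>+ \<or> a = v" using reach that(1) xyV by blast
    have 2: "(v, x) \<in> ?h\<^sup>+" using reach[OF xyV(2,1)] xv(2) by (meson trancl_trans)
    have 3: "(a, x) \<in> ?h\<^sup>+" using 1 2 by blast
    have 4: "(x, b) \<in> ?h\<^sup>+" using reach[of x b] that(2) xyV xv by blast
    show ?thesis using 3 4 by (meson trancl_trans)
  qed
  moreover have "?h \<subseteq> insert v V \<times> insert v V" using sub xyV by auto
  moreover have "\<exists>!b. (a, b) \<in> ?h" if aV: "a \<in> insert v V" for a
  proof -
    consider "a = v" | "a = x" "a \<noteq> v" | "a \<noteq> x" "a \<in> V" "a \<noteq> v" using aV by blast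
    then show ?thesis
    proof cases
      case 1
      then show ?thesis using sub v xyV by (intro ex1I[of _ y]) auto
    next
      case 2
      then show ?thesis using ham_cycle_succ_unique[OF h] xy by (intro ex1I[of _ v]) auto
    next
      case 3
      then obtain b where "(a, b) \<in> h" using ham_cycle_succ[OF h] by blast
      then show ?thesis using 3 ham_cycle_succ_unique[OF h] by (intro ex1I[of _ b]) auto
    qed
  qed
  moreover have "\<exists>!a. (a, b) \<in> ?h" if bV: "b \<in> insert v V" for b
  proof -
    consider "b = v" | "b = y" "b \<noteq> v" | "b \<noteq> y" "b \<in> V" "b \<noteq> v" using bV by blast
    then show ?thesis
    proof cases
      case 1
      then show ?thesis using sub v xyV by (intro ex1I[of _ x]) auto
    next
      case 2
      then show ?thesis using ham_cycle_pred_unique[OF h] xy by (intro ex1I[of _ v]) auto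
    next
      case 3
      then obtain a where "(a, b) \<in> h" using ham_cycle_pred[OF h] by blast
      then show ?thesis using 3 ham_cycle_pred_unique[OF h] by (intro ex1I[of _ a]) auto
    qed
  qed
  ultimately show ?thesis by (rule ham_cycleI)
qed

lemma ham_cycle_bypass:
  assumes h: "ham_cycle V h" and pu: "(p, u) \<in> h" and uw: "(u, w) \<in> h" and ne: "p \<noteq> u"
  shows "ham_cycle (V - {u}) (h - {(p, u), (u, w)} \<union> {(p, w)})"
proof -
  let ?h = "h - {(p, u), (u, w)} \<union> {(p, w)}"
  note sub = ham_cycle_subset[OF h]
  have V: "p \<in> V" "u \<in> V" "w \<in> V" using sub pu uw by auto
  have wu: "w \<noteq> u" using ham_cycle_pred_unique[OF h pu, of u] uw ne by auto
  have sub': "?h \<subseteq> (V - {u}) \<times> (V - {u})"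
    using sub V ne wu ham_cycle_succ_unique[OF h uw] ham_cycle_pred_unique[OF h pu] by auto
  have reach: "b \<noteq> u \<longrightarrow> (a, b) \<in> ?h\<^sup>+" if a: "a \<noteq> u" and "(a, b) \<in> h\<^sup>+" for a b
  proof -
    \<comment> \<open>A walk in \<open>h\<close> may pause at the removed vertex \<open>u\<close>;
      the second conjunct then remembers \<open>p\<close>, from where the new arc
      \<open>(p, w)\<close> resumes. It is reflexive because \<open>a\<close> may be
      \<open>p\<close> itself.\<close>
    have "(b \<noteq> u \<longrightarrow> (a, b) \<in> ?h\<^sup>+) \<and> (b = u \<longrightarrow> (a, p) \<in> ?h\<^sup>*)"
      using that(2)
    proof (induction rule: trancl_induct)
      case (base y)
      then show ?case using a ham_cycle_pred_unique[OF h pu, of a] by auto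
    next
      case (step y z)
      show ?case
      proof (cases "y = u")
        case True
        then have "z = w" using step.hyps(2) ham_cycle_succ_unique[OF h uw] by auto
        moreover have "(a, p) \<in> ?h\<^sup>*" using step.IH True by blast
        moreover have "(p, w) \<in> ?h" by blast
        ultimately have "(a, z) \<in> ?h\<^sup>+" by (metis rtrancl_into_trancl1)
        then show ?thesis using \<open>z = w\<close> wu by auto
      next
        case False
        then have ay: "(a, y) \<in> ?h\<^sup>+" using step.IH by blast
        show ?thesis
        proof (cases "z = u")
          case True
          then have "y = p" using step.hyps(2) ham_cycle_pred_unique[OF h pu] by auto
          then show ?thesis using ay True by (auto intro: trancl_into_rtrancl)
        next
          case z: False
          then have "(y, z) \<in> ?h" using step.hyps(2) False by auto
          then show ?thesis using ay z by (meson trancl.trancl_into_trancl)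
        qed
      qed
    qed
    then show ?thesis by blast
  qed
  have "(a, b) \<in> ?h\<^sup>+" if "a \<in> V - {u}" "b \<in> V - {u}" for a b
    using reach ham_cycle_trancl[OF h] that by blast
  moreover note sub'
  moreover have "\<exists>!b. (a, b) \<in> ?h" if aV: "a \<in> V - {u}" for a
  proof (cases "a = p")
    case True
    then show ?thesis using ham_cycle_succ_unique[OF h pu] by (intro ex1I[of _ w]) auto
  next
    case False
    obtain b where "(a, b) \<in> h" using ham_cycle_succ[OF h] aV by blast
    then show ?thesis using False aV ham_cycle_succ_unique[OF h] by (intro ex1I[of _ b]) auto
  qed
  moreover have "\<exists>!a. (a, b) \<in> ?h" if bV: "b \<in> V - {u}" for b
  proof (cases "b = w")
    case True
    then show ?thesis using ham_cycle_pred_unique[OF h uw] by (intro ex1I[of _ p]) auto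
  next
    case False
    obtain a where "(a, b) \<in> h" using ham_cycle_pred[OF h] bV by blast
    then show ?thesis using False bV ham_cycle_pred_unique[OF h] by (intro ex1I[of _ a]) auto
  qed
  ultimately show ?thesis by (rule ham_cycleI)
qed

lemma ham_cycle_image:
  assumes h: "ham_cycle V h" and bij: "bij_betw \<tau> V V"
  shows "ham_cycle V (map_prod \<tau> \<tau> ` h)"
proof -
  let ?h = "map_prod \<tau> \<tau> ` h"
  note sub = ham_cycle_subset[OF h]
  have inj: "inj_on \<tau> V" and im: "\<tau> ` V = V" using bij by (auto simp: bij_betw_def)
  have "(\<tau> a, \<tau> b) \<in> ?h\<^sup>+" if "(a, b) \<in> h\<^sup>+" for a b
    using that
  proof (induction rule: trancl_induct)
    case (step y z)
    have "(\<tau> y, \<tau> z) \<in> ?h" using step.hyps(2) by force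
    then show ?case using step.IH by (meson trancl.trancl_into_trancl)
  qed force
  then have "(a, b) \<in> ?h\<^sup>+" if "a \<in> V" "b \<in> V" for a b
    using that im ham_cycle_trancl[OF h] by (metis imageE)
  moreover have "?h \<subseteq> V \<times> V" using sub im by auto
  moreover have "\<exists>!b. (a, b) \<in> ?h" if a: "a \<in> V" for a
  proof -
    obtain a' where a': "a' \<in> V" "a = \<tau> a'" using a im by blast
    obtain b where b: "(a', b) \<in> h" using ham_cycle_succ[OF h a'(1)] by blast
    show ?thesis
    proof (rule ex1I[of _ "\<tau> b"])
      show "(a, \<tau> b) \<in> ?h" using b a' by force
      fix c assume "(a, c) \<in> ?h"
      then obtain x y where xy: "(x, y) \<in> h" "a = \<tau> x" "c = \<tau> y" by auto
      then have "x = a'" using a' inj sub by (auto dest: inj_onD)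
      then show "c = \<tau> b" using xy b ham_cycle_succ_unique[OF h] by auto
    qed
  qed
  moreover have "\<exists>!a. (a, b) \<in> ?h" if b: "b \<in> V" for b
  proof -
    obtain b' where b': "b' \<in> V" "b = \<tau> b'" using b im by blast
    obtain a where a: "(a, b') \<in> h" using ham_cycle_pred[OF h b'(1)] by blast
    show ?thesis
    proof (rule ex1I[of _ "\<tau> a"])
      show "(\<tau> a, b) \<in> ?h" using a b' by force
      fix c assume "(c, b) \<in> ?h"
      then obtain x y where xy: "(x, y) \<in> h" "c = \<tau> x" "b = \<tau> y" by auto
      then have "y = b'" using b' inj sub by (auto dest: inj_onD)
      then show "c = \<tau> a" using xy a ham_cycle_pred_unique[OF h] by auto
    qed
  qed
  ultimately show ?thesis by (rule ham_cycleI)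
qed

section \<open>Loops, opposite arcs and disjoint arcs in a cycle\<close>

lemma ham_cycle_irrefl:
  assumes h: "ham_cycle V h" and "card V \<noteq> 1"
  shows "(x, x) \<notin> h"
proof
  assume xx: "(x, x) \<in> h"
  have "{x} = V"
  proof (rule ham_cycle_closed[OF h])
    show "{x} \<subseteq> V" using xx ham_cycle_subset[OF h] by blast
    show "b \<in> {x}" if "a \<in> {x}" "(a, b) \<in> h" for a b
      using that ham_cycle_succ_unique[OF h xx] by blast
  qed simp
  then show False using assms by auto
qed

lemma ham_cycle_asym:
  assumes h: "ham_cycle V h" and "3 \<le> card V" and xy: "(x, y) \<in> h"
  shows "(y, x) \<notin> h"
proof
  assume yx: "(y, x) \<in> h"
  have "{x, y} = V"
  proof (rule ham_cycle_closed[OF h])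
    show "{x, y} \<subseteq> V" using xy ham_cycle_subset[OF h] by blast
    show "b \<in> {x, y}" if "a \<in> {x, y}" "(a, b) \<in> h" for a b
      using that ham_cycle_succ_unique[OF h xy] ham_cycle_succ_unique[OF h yx] by blast
  qed simp
  moreover have "card {x, y} \<le> 2" by (simp add: card_insert_if)
  ultimately have "card V \<le> 2" by simp
  then show False using assms by auto
qed

lemma card_ham_cycle:
  assumes h: "ham_cycle V h"
  shows "card h = card V"
proof -
  have "inj_on fst h" using ham_cycle_succ_unique[OF h] by (auto simp: inj_on_def)
  moreover have "fst ` h = V"
    using ham_cycle_subset[OF h] ham_cycle_succ[OF h] by force
  ultimately show ?thesis by (metis card_image)
qed

text \<open>Distinct cycle arcs meet only head to tail, so three pairwise meeting ones form a
  triangle. Its vertex set is closed under successors, hence all of \<open>V\<close>, against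
  \<open>4 \<le> card V\<close>.\<close>

lemma ham_cycle_disjoint_arcs:
  assumes h: "ham_cycle V h" and V: "4 \<le> card V" and S: "S \<subseteq> h" "3 \<le> card S"
  shows "\<exists>x y u v. (x, y) \<in> S \<and> (u, v) \<in> S \<and> {x, y} \<inter> {u, v} = {}"
proof (rule ccontr)
  assume no: "\<not> ?thesis"
  obtain S' where "S' \<subseteq> S" "card S' = 3" using obtain_subset_with_card_n[OF S(2)] by metis
  then obtain e1 e2 e3 where e: "e1 \<in> S" "e2 \<in> S" "e3 \<in> S" "e1 \<noteq> e2" "e2 \<noteq> e3" "e1 \<noteq> e3"
    by (auto simp: card_3_iff)
  obtain x1 y1 x2 y2 x3 y3 where xy: "e1 = (x1, y1)" "e2 = (x2, y2)" "e3 = (x3, y3)"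
    by (metis surj_pair)
  have hh: "(x1, y1) \<in> h" "(x2, y2) \<in> h" "(x3, y3) \<in> h" using e xy S(1) by auto
  have meet: "y = u \<or> v = x" if "(x, y) \<in> S" "(u, v) \<in> S" "(x, y) \<noteq> (u, v)" for x y u v
  proof -
    have "x \<noteq> u" "y \<noteq> v"
      using that S(1) ham_cycle_succ_unique[OF h] ham_cycle_pred_unique[OF h] by blast+
    then show ?thesis using no that(1,2) by blast
  qed
  have m: "y1 = x2 \<or> y2 = x1" "y2 = x3 \<or> y3 = x2" "y1 = x3 \<or> y3 = x1"
    using meet e unfolding xy by blast+
  have ne: "x1 \<noteq> x2" "x2 \<noteq> x3" "x1 \<noteq> x3" "y1 \<noteq> y2" "y2 \<noteq> y3" "y1 \<noteq> y3"
    using e xy hh ham_cycle_succ_unique[OF h] ham_cycle_pred_unique[OF h] by blast+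
  have y: "y1 \<in> {x1, x2, x3}" "y2 \<in> {x1, x2, x3}" "y3 \<in> {x1, x2, x3}"
    using m ne by blast+
  have "{x1, x2, x3} = V"
  proof (rule ham_cycle_closed[OF h])
    show "{x1, x2, x3} \<subseteq> V" using hh ham_cycle_subset[OF h] by blast
    show "b \<in> {x1, x2, x3}" if "a \<in> {x1, x2, x3}" "(a, b) \<in> h" for a b
      using that y hh ham_cycle_succ_unique[OF h] by blast
  qed simp
  moreover have "card {x1, x2, x3} \<le> 3" by (simp add: card_insert_if)
  ultimately show False using V by simp
qed

section \<open>Camion's theorem\<close>

lemma strong_exit:
  assumes "(x, y) \<in> R\<^sup>*" "x \<in> X" "y \<notin> X"
  shows "\<exists>a b. a \<in> X \<and> b \<notin> X \<and> (a, b) \<in> R"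
  using assms by (induction rule: rtrancl_induct) blast+

text \<open>A largest cycle \<open>C\<close> admits no insertion, so an outside vertex that receives
  one arc from \<open>C\<close> receives arcs from all of \<open>C\<close> and sends none back.
  Leaving the set \<open>X\<close> of such vertices therefore leads to a vertex \<open>w\<close>
  outside \<open>C\<close> that dominates \<open>C\<close>, and then \<open>u\<close> and
  \<open>w\<close> can be inserted together.\<close>

theorem strong_semicomplete_ham_cycle:
  fixes R :: "('a \<times> 'a) set"
  assumes fin: "finite V" and V: "2 \<le> card V" and R: "R \<subseteq> V \<times> V"
    and semi: "\<And>u v. u \<in> V \<Longrightarrow> v \<in> V \<Longrightarrow> u \<noteq> v \<Longrightarrow> (u, v) \<in> R \<or> (v, u) \<in> R"
    and strong: "\<And>u v. u \<in> V \<Longrightarrow> v \<in> V \<Longrightarrow> (u, v) \<in> R\<^sup>*"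
  shows "\<exists>h \<subseteq> R. ham_cycle V h"
proof -
  \<comment> \<open>\<open>Id\<close> admits the loop on one vertex as initial cycle. It drops out
    at the end, because a Hamiltonian cycle on at least two vertices has no loop.\<close>
  define P where "P = (\<lambda>C. C \<subseteq> V \<and> (\<exists>h. h \<subseteq> R \<union> Id \<and> C \<noteq> {} \<and> ham_cycle C h))"
  have PI: "P D" if "ham_cycle D g" "D \<subseteq> V" "g \<subseteq> R \<union> Id" "D \<noteq> {}" for D g
    using that unfolding P_def by blast
  obtain x0 where x0: "x0 \<in> V" using V by fastforce
  have "ham_cycle {x0} {(x0, x0)}" unfolding ham_cycle_def by auto
  then have P0: "P {x0}" by (rule PI) (use x0 in auto)
  define C where "C = (ARG_MAX card C. P C)"
  have bound: "\<forall>C. P C \<longrightarrow> card C < Suc (card V)"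
    unfolding P_def using fin by (auto simp: less_Suc_eq_le card_mono)
  have PC: "P C" unfolding C_def by (rule arg_max_natI[OF P0 bound])
  have max: "card C' \<le> card C" if "P C'" for C'
    unfolding C_def by (rule arg_max_nat_le[OF that bound])
  obtain h where CV: "C \<subseteq> V" and hR: "h \<subseteq> R \<union> Id" and C: "C \<noteq> {}" and h: "ham_cycle C h"
    using PC unfolding P_def by blast
  have finC: "finite C" using CV fin finite_subset by blast
  have noP: "\<not> P C'" if "C \<subset> C'" "C' \<subseteq> V" for C'
  proof
    assume "P C'"
    then have "card C' \<le> card C" by (rule max)
    moreover have "card C < card C'" using that fin finite_subset by (intro psubset_card_mono) auto
    ultimately show False by simp
  qed
  have no_insert: "\<not> ((x, v) \<in> R \<and> (v, y) \<in> R)" if "(x, y) \<in> h" "v \<in> V - C" for x y v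
  proof
    assume xvy: "(x, v) \<in> R \<and> (v, y) \<in> R"
    have "ham_cycle (insert v C) (h - {(x, y)} \<union> {(x, v), (v, y)})"
      using ham_cycle_insert[OF h that(1)] that(2) by blast
    moreover have "h - {(x, y)} \<union> {(x, v), (v, y)} \<subseteq> R \<union> Id" using hR xvy by blast
    ultimately have "P (insert v C)" using CV that(2) by (intro PI) auto
    then show False using noP[of "insert v C"] that(2) CV by blast
  qed
  have no_insert2: "\<not> ((x, u) \<in> R \<and> (u, w) \<in> R \<and> (w, y) \<in> R)"
    if "(x, y) \<in> h" "u \<in> V - C" "w \<in> V - C" "u \<noteq> w" for x y u w
  proof
    assume xuwy: "(x, u) \<in> R \<and> (u, w) \<in> R \<and> (w, y) \<in> R"
    let ?h = "h - {(x, y)} \<union> {(x, u), (u, y)}"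
    have "ham_cycle (insert u C) ?h"
      using ham_cycle_insert[OF h that(1)] that(2) by blast
    then have "ham_cycle (insert w (insert u C)) (?h - {(u, y)} \<union> {(u, w), (w, y)})"
      by (rule ham_cycle_insert) (use that in auto)
    moreover have "?h - {(u, y)} \<union> {(u, w), (w, y)} \<subseteq> R \<union> Id" using hR xuwy by blast
    ultimately have "P (insert w (insert u C))" using CV that(2,3) by (intro PI) auto
    then show False using noP[of "insert w (insert u C)"] that(2,3) CV by blast
  qed
  have dom: "(\<forall>x\<in>C. (x, v) \<in> R \<and> (v, x) \<notin> R)" if v: "v \<in> V - C" and xv: "x \<in> C" "(x, v) \<in> R" for v x
  proof -
    \<comment> \<open>If \<open>a\<close> sends an arc to \<open>v\<close>, its successor
      \<open>b\<close> cannot receive one from \<open>v\<close>, so semicompleteness gives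
      \<open>(b, v)\<close>.\<close>
    have "{x\<in>C. (x, v) \<in> R} = C"
    proof (rule ham_cycle_closed[OF h])
      fix a b assume a: "a \<in> {x\<in>C. (x, v) \<in> R}" and ab: "(a, b) \<in> h"
      have "b \<in> C" using ham_cycle_subset[OF h] ab by blast
      moreover have "(v, b) \<notin> R" using no_insert[OF ab v] a by blast
      ultimately show "b \<in> {x\<in>C. (x, v) \<in> R}" using semi[of v b] v CV by blast
    qed (use xv in auto)
    then have all: "\<forall>x\<in>C. (x, v) \<in> R" by blast
    moreover have "(v, y) \<notin> R" if y: "y \<in> C" for y
    proof -
      obtain a where a: "(a, y) \<in> h" using ham_cycle_pred[OF h y] by blast
      then have "a \<in> C" using ham_cycle_subset[OF h] by blast
      then show ?thesis using no_insert[OF a v] all by blast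
    qed
    ultimately show ?thesis by blast
  qed
  have "C = V"
  proof (rule ccontr)
    assume "C \<noteq> V"
    then obtain v where v: "v \<in> V - C" using CV by blast
    obtain c where c: "c \<in> C" using C by blast
    obtain a b where ab: "a \<in> C" "b \<notin> C" "(a, b) \<in> R"
      using strong_exit[of c v R C] strong[of c v] c v CV by blast
    define X where "X = {u \<in> V - C. \<exists>x\<in>C. (x, u) \<in> R}"
    have "b \<in> X" unfolding X_def using ab R by blast
    then obtain u w where uw: "u \<in> X" "w \<notin> X" "(u, w) \<in> R"
      using strong_exit[of b c R X] strong[of b c] c CV unfolding X_def by blast
    have u: "u \<in> V - C" "\<And>x. x \<in> C \<Longrightarrow> (x, u) \<in> R \<and> (u, x) \<notin> R"
      using uw(1) dom unfolding X_def by blast+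
    then have w: "w \<in> V - C" using uw(3) R by blast
    have wC: "(w, x) \<in> R" if "x \<in> C" for x
      using uw(2) w semi[of w x] that CV unfolding X_def by blast
    obtain d where cd: "(c, d) \<in> h" using ham_cycle_succ[OF h c] by blast
    then have "d \<in> C" using ham_cycle_subset[OF h] by blast
    moreover have "u \<noteq> w" using uw by blast
    ultimately show False using no_insert2[OF cd u(1) w] u(2)[OF c] uw(3) wC by blast
  qed
  moreover from this have "h \<subseteq> R"
    using hR ham_cycle_irrefl[OF h] V by fastforce
  ultimately show ?thesis using h by blast
qed

text \<open>Take \<open>z\<close> with the most vertices reaching it. If \<open>x\<close> did not
  reach \<open>z\<close>, then \<open>(z, x)\<close> would be an arc, and \<open>x\<close> would be
  reached by all of these and by itself.\<close>

lemma semicomplete_sink: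
  assumes fin: "finite V" and V: "V \<noteq> {}" and R: "R \<subseteq> V \<times> V"
    and semi: "\<And>u v. u \<in> V \<Longrightarrow> v \<in> V \<Longrightarrow> u \<noteq> v \<Longrightarrow> (u, v) \<in> R \<or> (v, u) \<in> R"
  shows "\<exists>z\<in>V. \<forall>x\<in>V. (x, z) \<in> R\<^sup>*"
proof -
  define r where "r z = {x \<in> V. (x, z) \<in> R\<^sup>*}" for z
  have "finite ((\<lambda>z. card (r z)) ` V)" using fin by blast
  then have "Max ((\<lambda>z. card (r z)) ` V) \<in> (\<lambda>z. card (r z)) ` V" using V by (intro Max_in) auto
  then obtain z where z: "z \<in> V" "card (r z) = Max ((\<lambda>z. card (r z)) ` V)" by force
  have "(x, z) \<in> R\<^sup>*" if x: "x \<in> V" for x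
  proof (rule ccontr)
    assume nx: "(x, z) \<notin> R\<^sup>*"
    then have "(z, x) \<in> R" using semi[of x z] x z(1) by blast
    then have "r z \<subseteq> r x" unfolding r_def by (auto intro: rtrancl_into_rtrancl)
    moreover have "x \<in> r x" "x \<notin> r z" using nx x unfolding r_def by auto
    ultimately have "r z \<subset> r x" by blast
    then have "card (r z) < card (r x)" using fin by (intro psubset_card_mono) (auto simp: r_def)
    moreover have "card (r x) \<le> card (r z)" using fin x unfolding z(2) by simp
    ultimately show False by simp
  qed
  then show ?thesis using z by blast
qed

lemma semicomplete_source:
  assumes fin: "finite V" and V: "V \<noteq> {}" and R: "R \<subseteq> V \<times> V"
    and semi: "\<And>u v. u \<in> V \<Longrightarrow> v \<in> V \<Longrightarrow> u \<noteq> v \<Longrightarrow> (u, v) \<in> R \<or> (v, u) \<in> R"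
  shows "\<exists>z\<in>V. \<forall>x\<in>V. (z, x) \<in> R\<^sup>*"
proof -
  have "\<exists>z\<in>V. \<forall>x\<in>V. (x, z) \<in> (R\<inverse>)\<^sup>*"
    using R semi by (intro semicomplete_sink[OF fin V]) auto
  then show ?thesis by (simp add: rtrancl_converse)
qed

section \<open>The case n = 7, k = 4\<close>

text \<open>Abstracts the case n = 7, k = 4, so that it can be mirrored: reversing all hyperarcs
  exchanges the two orientations in \<open>gens\<close>.\<close>

locale seven_four =
  fixes V :: "'a set" and gens :: "'a \<times> 'a \<Rightarrow> 'b set"
  assumes card_V: "card V = 7"
    and finite_gens: "finite (gens e)"
    and gens_disjoint: "gens (u, v) \<inter> gens (v, u) = {}"
    and card_both: "u \<in> V \<Longrightarrow> v \<in> V \<Longrightarrow> u \<noteq> v \<Longrightarrow> card (gens (u, v) \<union> gens (v, u)) = 10"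
    and gens_trans: "a \<in> gens (u, v) \<Longrightarrow> a \<in> gens (v, w) \<Longrightarrow> a \<in> gens (u, w)"
    and share: "{u, v, x, y} \<subseteq> V \<Longrightarrow> u \<noteq> v \<Longrightarrow> x \<noteq> y \<Longrightarrow> {u, v} \<noteq> {x, y} \<Longrightarrow>
      card (gens (u, v) \<inter> gens (x, y)) \<le> 4"
    and share_disjoint: "{u, v, x, y} \<subseteq> V \<Longrightarrow> u \<noteq> v \<Longrightarrow> x \<noteq> y \<Longrightarrow> {u, v} \<inter> {x, y} = {} \<Longrightarrow>
      card (gens (u, v) \<inter> gens (x, y)) \<le> 1"
begin

lemma card_gens_rev: "u \<in> V \<Longrightarrow> v \<in> V \<Longrightarrow> u \<noteq> v \<Longrightarrow> card (gens (u, v)) + card (gens (v, u)) = 10"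
  using card_both[of u v] card_Un_disjoint[OF finite_gens finite_gens gens_disjoint, of u v] by simp

lemma finite_V: "finite V" using card_V by (simp add: card_ge_0_finite)

lemma seven_four_mirror: "seven_four V (\<lambda>e. gens (prod.swap e))"
proof
  fix u v x y
  assume *: "{u, v, x, y} \<subseteq> V" "u \<noteq> v" "x \<noteq> y"
  show "card (gens (prod.swap (u, v)) \<inter> gens (prod.swap (x, y))) \<le> 4" if "{u, v} \<noteq> {x, y}"
    using share[of v u y x] * that by (simp add: insert_commute)
  show "card (gens (prod.swap (u, v)) \<inter> gens (prod.swap (x, y))) \<le> 1" if "{u, v} \<inter> {x, y} = {}"
    using share_disjoint[of v u y x] * that by (simp add: insert_commute)
qed (use card_V finite_gens gens_disjoint card_both gens_trans in \<open>auto simp: Un_commute\<close>)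

lemma arc_facts:
  assumes "ham_cycle V h" "(u, v) \<in> h"
  shows "u \<in> V" "v \<in> V" "u \<noteq> v" "(v, u) \<notin> h"
  using assms ham_cycle_subset[OF assms(1)] ham_cycle_irrefl[OF assms(1)]
    ham_cycle_asym[OF assms(1) _ assms(2)] card_V by auto

text \<open>Inclusion-exclusion gives 5 + 5 - 4. The arcs span different pairs because a cycle on 7
  vertices has no opposite arcs.\<close>

lemma card_two_arcs:
  assumes h: "ham_cycle V h" and e: "e \<in> h" "e' \<in> h" "e \<noteq> e'" "5 \<le> card (gens e)" "5 \<le> card (gens e')"
  shows "6 \<le> card (gens e \<union> gens e')"
proof -
  obtain u v x y where uv: "e = (u, v)" "e' = (x, y)" by (metis surj_pair)
  have "{u, v} \<noteq> {x, y}"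
    using arc_facts[OF h e(1)[unfolded uv]] arc_facts[OF h e(2)[unfolded uv]] e uv
    by (auto simp: doubleton_eq_iff)
  then have "card (gens e \<inter> gens e') \<le> 4"
    unfolding uv using arc_facts[OF h e(1)[unfolded uv]] arc_facts[OF h e(2)[unfolded uv]]
    by (intro share) auto
  moreover have "card (gens e) + card (gens e') = card (gens e \<union> gens e') + card (gens e \<inter> gens e')"
    by (rule card_Un_Int) (rule finite_gens)+
  ultimately show ?thesis using e by linarith
qed

lemma card_disjoint_arcs:
  assumes h: "ham_cycle V h" and e: "(u, v) \<in> h" "(x, y) \<in> h" "{u, v} \<inter> {x, y} = {}"
    and "5 \<le> card (gens (u, v))" "5 \<le> card (gens (x, y))"
  shows "9 \<le> card (gens (u, v) \<union> gens (x, y))"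
proof -
  have "card (gens (u, v) \<inter> gens (x, y)) \<le> 1"
    using arc_facts[OF h e(1)] arc_facts[OF h e(2)] e(3) by (intro share_disjoint) auto
  moreover have "card (gens (u, v)) + card (gens (x, y))
      = card (gens (u, v) \<union> gens (x, y)) + card (gens (u, v) \<inter> gens (x, y))"
    by (rule card_Un_Int) (rule finite_gens)+
  ultimately show ?thesis using assms by linarith
qed

text \<open>One arc in \<open>S\<close> keeps 5 - 4 values, two keep 6 - 4, and three or more
  include two disjoint arcs with 9 values, enough because \<open>card S + card W \<le> 7\<close>.
  With five arcs in \<open>W\<close> already the first count breaks down.\<close>

lemma sdr_few_weak:
  assumes h: "ham_cycle V h" and W: "W \<subseteq> h" "card W \<le> 4"
    and f: "inj_on f W" "\<And>e. e \<in> W \<Longrightarrow> f e \<in> gens e"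
    and strong: "\<And>e. e \<in> h - W \<Longrightarrow> 5 \<le> card (gens e)"
  shows "sdr gens h"
proof -
  have finh: "finite h" using ham_cycle_subset[OF h] finite_V finite_subset by blast
  have finW: "finite W" using W finh finite_subset by blast
  have "sdr gens (W \<union> (h - W))"
  proof (rule Hall_extend[OF f])
    show "finite (h - W)" using finh by blast
    show "finite (gens e)" for e by (rule finite_gens)
    fix S assume S: "S \<subseteq> h - W"
    have finS: "finite S" using S finh finite_subset by blast
    let ?N = "\<Union>(gens ` S)"
    have finN: "finite ?N" using finS finite_gens by blast
    have "card (S \<union> W) \<le> card h" using S W finh by (intro card_mono) auto
    then have sum: "card S + card W \<le> 7"
      using S W finS finW card_ham_cycle[OF h] card_V by (subst (asm) card_Un_disjoint) auto
    have diff: "card ?N - card W \<le> card (?N - f ` W)"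
      using diff_card_le_card_Diff[of "f ` W" ?N] card_image_le[OF finW, of f] finW by simp
    consider "card S = 0" | "card S = 1" | "card S = 2" | "3 \<le> card S" by linarith
    then show "card S \<le> card (?N - f ` W)"
    proof cases
      case 2
      then obtain e where "S = {e}" by (metis card_1_singletonE)
      then have "5 \<le> card ?N" using strong S by simp
      then show ?thesis using 2 diff W by linarith
    next
      case 3
      then obtain e e' where e: "S = {e, e'}" "e \<noteq> e'" by (metis card_2_iff)
      then have "6 \<le> card ?N" using card_two_arcs[OF h, of e e'] strong S by simp
      then show ?thesis using 3 diff W by linarith
    next
      case 4
      have "S \<subseteq> h" "4 \<le> card V" using S card_V by auto
      then obtain x y u v where xy: "(x, y) \<in> S" "(u, v) \<in> S" "{x, y} \<inter> {u, v} = {}"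
        using ham_cycle_disjoint_arcs[OF h _ _ 4] by meson
      then have "9 \<le> card (gens (x, y) \<union> gens (u, v))"
        using S by (intro card_disjoint_arcs[OF h] strong) auto
      also have "\<dots> \<le> card ?N" using xy finN by (intro card_mono) auto
      finally show ?thesis using diff sum by linarith
    qed simp
  qed
  moreover have "W \<union> (h - W) = h" using W by blast
  ultimately show ?thesis by simp
qed

text \<open>For modified cycles in which at most two arcs may be weak; only these get explicit
  values. \<open>e = e'\<close> is allowed.\<close>

lemma sdr_few_weak_pair:
  assumes h: "ham_cycle V h" and e: "{e, e'} \<subseteq> h"
    and ab: "a \<in> gens e" "b \<in> gens e'" "a \<noteq> b"
    and strong: "\<And>e0. e0 \<in> h - {e, e'} \<Longrightarrow> 5 \<le> card (gens e0)"
  shows "sdr gens h"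
proof -
  obtain f where "inj_on f {e, e'}" "\<forall>i\<in>{e, e'}. f i \<in> gens i"
    using sdr_pair[of a gens e b e'] ab unfolding sdr_def by blast
  moreover have "card {e, e'} \<le> 4" by (simp add: card_insert_if)
  ultimately show ?thesis using e strong by (intro sdr_few_weak[OF h, of "{e, e'}" f]) auto
qed

lemma tight_successor:
  assumes h: "ham_cycle V h" "h = W \<union> {(u, w), e'}" and ne: "(u, w) \<notin> W" "e' \<notin> W" "e' \<noteq> (u, w)"
    and W: "card W = 5" "\<And>e. e \<in> W \<Longrightarrow> card (gens e) \<le> 4"
    and f: "inj_on f W" "\<And>e. e \<in> W \<Longrightarrow> f e \<in> gens e"
    and tight: "gens (u, w) = f ` W" and full: "card (gens e') = 10" and q: "(w, q) \<in> W"
  shows "\<exists>h'. ham_cycle V h' \<and> sdr gens h'"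
proof -
  have Wh: "W \<subseteq> h" and uwh: "(u, w) \<in> h" and e'h: "e' \<in> h" using h(2) by auto
  have finW: "finite W" using W(1) by (simp add: card_ge_0_finite)
  have wqh: "(w, q) \<in> h" using q Wh by blast
  note uw = arc_facts[OF h(1) uwh] and wq = arc_facts[OF h(1) wqh]
  obtain p where p: "(p, u) \<in> h" using ham_cycle_pred[OF h(1) uw(1)] by blast
  note pu = arc_facts[OF h(1) p]
  have cfW: "card (f ` W) = 5" using W(1) f(1) by (simp add: card_image)
  have cuw: "card (gens (u, w)) = 5" using tight cfW by simp
  then have cwu: "card (gens (w, u)) = 5" using card_gens_rev[OF uw(1-3)] by simp
  have pw: "p \<noteq> w" using pu(4) uwh by blast
  have qu: "q \<noteq> u" using wq(4) uwh by blast
  note su = ham_cycle_succ_unique[OF h(1)] and pre = ham_cycle_pred_unique[OF h(1)]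
  show ?thesis
  proof (cases "(p, u) \<in> W \<or> \<not> gens (p, w) \<subseteq> f ` W")
    case True
    text \<open>Exchange \<open>u\<close> and \<open>w\<close> on the cycle. Every representative in \<open>f ` W\<close> has \<open>u\<close> before \<open>w\<close>,
      so those of the neighbouring arcs still serve the new arcs by transitivity.\<close>
    define \<tau> where "\<tau> = (\<lambda>x. if x = u then w else if x = w then u else x)"
    have bij: "bij_betw \<tau> V V"
      by (rule bij_betw_byWitness[where f' = \<tau>]) (use uw in \<open>auto simp: \<tau>_def\<close>)
    let ?t = "map_prod \<tau> \<tau>"
    have inj: "inj_on ?t h"
      using map_prod_inj_on[of \<tau> V \<tau> V] bij ham_cycle_subset[OF h(1)]
      by (meson bij_betw_imp_inj_on inj_on_subset)
    have tW: "f e \<in> gens (?t e)" if e: "e \<in> W" for e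
    proof -
      obtain x y where xy: "e = (x, y)" by (metis surj_pair)
      have xyh: "(x, y) \<in> h" using e xy Wh by blast
      have fe: "f e \<in> gens (x, y)" "f e \<in> gens (u, w)" using f(2)[OF e] xy tight e by auto
      have "x \<noteq> u" using su[OF xyh, of w] uwh e ne(1) xy by auto
      moreover have "y \<noteq> w" using pre[OF xyh, of u] uwh e ne(1) xy by auto
      ultimately consider "x \<noteq> u" "x \<noteq> w" "y \<noteq> u" "y \<noteq> w" | "y = u" "x \<noteq> u" "x \<noteq> w"
        | "x = w" "y \<noteq> w" "y \<noteq> u"
        using xyh uw(4) by blast
      then show ?thesis
      proof cases
        case 1
        then show ?thesis using fe xy by (simp add: \<tau>_def)
      next
        case 2
        then show ?thesis using fe xy gens_trans[of "f e" x u w] by (simp add: \<tau>_def)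
      next
        case 3
        then show ?thesis using fe xy gens_trans[of "f e" u w y] uw(3) by (simp add: \<tau>_def)
      qed
    qed
    have "\<exists>d. d \<in> gens (?t e') \<and> d \<notin> f ` W"
    proof (cases "(p, u) \<in> W")
      case True
      obtain x y where xy: "e' = (x, y)" by (metis surj_pair)
      have xyh: "(x, y) \<in> h" using e'h xy by blast
      have "x \<noteq> u" using su[OF xyh, of w] uwh ne xy by auto
      moreover have "y \<noteq> w" using pre[OF xyh, of u] uwh ne xy by auto
      moreover have "x \<noteq> w" using su[OF xyh, of q] wqh q ne xy by auto
      moreover have "y \<noteq> u" using pre[OF xyh, of p] p True ne xy by auto
      ultimately have "?t e' = e'" by (simp add: \<tau>_def xy)
      then show ?thesis using ex_mem_notin[of "f ` W" "gens e'"] full cfW finW by auto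
    next
      case False
      then have "e' = (p, u)" using p h(2) pu by auto
      then have "?t e' = (p, w)" using pu pw by (simp add: \<tau>_def)
      then show ?thesis using True False by auto
    qed
    then obtain d where d: "d \<in> gens (?t e')" "d \<notin> f ` W" by blast
    obtain c where c: "c \<in> gens (w, u)" "c \<noteq> d"
      using ex_mem_notin[of "{d}" "gens (w, u)"] cwu by auto
    have "c \<notin> f ` W" using c(1) gens_disjoint[of u w] tight by blast
    moreover have "?t (u, w) = (w, u)" by (simp add: \<tau>_def)
    ultimately have "sdr (\<lambda>e. gens (?t e)) (W \<union> {(u, w), e'})"
      using sdr_Un_pair[of f W "\<lambda>e. gens (?t e)" c "(u, w)" d e'] f(1) tW c d by simp
    then have "sdr gens (?t ` h)" using sdr_image[OF inj] h(2) by simp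
    then show ?thesis using ham_cycle_image[OF h(1) bij] by blast
  next
    case False
    text \<open>Otherwise the reversed cycle with \<open>u\<close> bypassed consists of strong arcs,
      and \<open>u\<close> can be inserted into it somewhere between \<open>p\<close> and \<open>w\<close>.\<close>
    then have e': "e' = (p, u)" using p h(2) pu by auto
    have "card (gens (p, w)) \<le> 5" using False card_mono[of "f ` W" "gens (p, w)"] finW cfW by simp
    then have cwp: "5 \<le> card (gens (w, p))" using card_gens_rev[of p w] pu uw pw by linarith
    \<comment> \<open>\<open>(w, p)\<close> is strong because at most 5 hyperarcs generate
      \<open>(p, w)\<close>; the other arcs are reversed weak arcs, with at least 6 hyperarcs
      each.\<close>
    define g where "g = (h - {(p, u), (u, w)} \<union> {(p, w)})\<inverse>"
    have g: "ham_cycle (V - {u}) g"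
      unfolding g_def by (intro ham_cycle_converse ham_cycle_bypass[OF h(1) p uwh pu(3)])
    have strong: "5 \<le> card (gens e)" if e: "e \<in> g" for e
    proof -
      obtain x y where xy: "e = (x, y)" by (metis surj_pair)
      then consider "x = w" "y = p" | "(y, x) \<in> W" using e h(2) e' unfolding g_def by auto
      then show ?thesis
      proof cases
        case 2
        then have "(y, x) \<in> h" using Wh by blast
        then show ?thesis
          using card_gens_rev[of y x] arc_facts[OF h(1), of y x] W(2)[OF 2] xy by auto
      qed (use cwp xy in auto)
    qed
    have "\<exists>x y a b. (x, y) \<in> g \<and> a \<in> gens (x, u) \<and> b \<in> gens (u, y) \<and> a \<noteq> b"
    proof (rule ccontr)
      assume no: "\<not> ?thesis"
      \<comment> \<open>If no arc of \<open>g\<close> admits \<open>u\<close>, emptiness of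
        \<open>gens (u, x)\<close> passes to the successor \<open>y\<close>: all 10 hyperarcs on the
        pair generate \<open>(x, u)\<close>, so any \<open>b\<close> for \<open>(u, y)\<close> would
        find a different partner. It holds at \<open>p\<close>, since \<open>e' = (p, u)\<close> is
        full, and so would reach \<open>w\<close>.\<close>
      have "{x \<in> V - {u}. gens (u, x) = {}} = V - {u}"
      proof (rule ham_cycle_closed[OF g])
        have "card (gens (u, p)) = 0" using card_gens_rev[OF pu(1-3)] full e' by simp
        then show "{x \<in> V - {u}. gens (u, x) = {}} \<noteq> {}" using pu finite_gens by auto
        fix x y assume x: "x \<in> {x \<in> V - {u}. gens (u, x) = {}}" and xy: "(x, y) \<in> g"
        have yV: "y \<in> V - {u}" using ham_cycle_subset[OF g] xy by blast
        have "card (gens (x, u)) = 10" using card_gens_rev[of x u] x uw by simp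
        moreover have "gens (x, u) \<subseteq> {b}" if "b \<in> gens (u, y)" for b
          using no xy that by blast
        ultimately have "gens (u, y) = {}"
          using card_mono[of "{b}" "gens (x, u)" for b] by fastforce
        then show "y \<in> {x \<in> V - {u}. gens (u, x) = {}}" using yV by simp
      qed blast
      moreover have "w \<in> V - {u}" using uw by auto
      ultimately have "gens (u, w) = {}" by blast
      then show False using cuw by simp
    qed
    then obtain x y a b where ab: "(x, y) \<in> g" "a \<in> gens (x, u)" "b \<in> gens (u, y)" "a \<noteq> b" by blast
    let ?h = "g - {(x, y)} \<union> {(x, u), (u, y)}"
    have "ham_cycle (insert u (V - {u})) ?h" by (rule ham_cycle_insert[OF g ab(1)]) simp
    then have h': "ham_cycle V ?h" using uw(1) by (simp add: insert_absorb)
    have "sdr gens ?h" by (rule sdr_few_weak_pair[OF h' _ ab(2-4)]) (use strong in auto)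
    then show ?thesis using h' by blast
  qed
qed

text \<open>The only other strong arc \<open>e'\<close> cannot both enter \<open>u\<close> and leave
  \<open>w\<close>, so one neighbour of \<open>(u, w)\<close> on the cycle is weak. If it is the one
  entering \<open>u\<close>, reversing the cycle and all hyperarcs moves it to the side already
  treated.\<close>

lemma tight_arc:
  assumes h: "ham_cycle V h" "h = W \<union> {(u, w), e'}" and ne: "(u, w) \<notin> W" "e' \<notin> W" "e' \<noteq> (u, w)"
    and W: "card W = 5" "\<And>e. e \<in> W \<Longrightarrow> card (gens e) \<le> 4"
    and f: "inj_on f W" "\<And>e. e \<in> W \<Longrightarrow> f e \<in> gens e"
    and tight: "gens (u, w) = f ` W" and full: "card (gens e') = 10"
  shows "\<exists>h'. ham_cycle V h' \<and> sdr gens h'"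
proof -
  have uwh: "(u, w) \<in> h" using h(2) by auto
  note uw = arc_facts[OF h(1) uwh]
  obtain p where p: "(p, u) \<in> h" using ham_cycle_pred[OF h(1) uw(1)] by blast
  obtain q where q: "(w, q) \<in> h" using ham_cycle_succ[OF h(1) uw(2)] by blast
  show ?thesis
  proof (cases "(w, q) \<in> W")
    case True
    then show ?thesis using tight_successor[OF assms] by blast
  next
    case False
    then have "e' = (w, q)" using q h(2) uw(3) by auto
    moreover have "p \<noteq> w" using p uw(4) by blast
    ultimately have pW: "(p, u) \<in> W" using p h(2) uw(3) arc_facts[OF h(1) p] by auto
    interpret M: seven_four V "\<lambda>e. gens (prod.swap e)" by (rule seven_four_mirror)
    have "\<exists>h'. ham_cycle V h' \<and> sdr (\<lambda>e. gens (prod.swap e)) h'"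
    proof (rule M.tight_successor)
      show "ham_cycle V (h\<inverse>)" by (rule ham_cycle_converse[OF h(1)])
      show "h\<inverse> = prod.swap ` W \<union> {(w, u), prod.swap e'}" unfolding h(2) by (cases e') force
      show "(w, u) \<notin> prod.swap ` W" "prod.swap e' \<notin> prod.swap ` W" "prod.swap e' \<noteq> (w, u)"
        using ne by (cases e'; auto)+
      show "card (prod.swap ` W) = 5" using W(1) by (simp add: card_image)
      show "inj_on (f \<circ> prod.swap) (prod.swap ` W)"
        using f(1) by (auto simp: inj_on_def)
      show "gens (prod.swap (w, u)) = (f \<circ> prod.swap) ` prod.swap ` W"
        using tight by (simp add: image_image)
      show "(u, p) \<in> prod.swap ` W" using pW by force
    qed (use W(2) f(2) full in auto)
    then obtain h' where h': "ham_cycle V h'" "sdr (\<lambda>e. gens (prod.swap e)) h'" by blast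
    have "sdr gens (prod.swap ` h')" by (rule sdr_image) (use h' in auto)
    moreover have "prod.swap ` h' = h'\<inverse>" by force
    ultimately show ?thesis using ham_cycle_converse[OF h'(1)] by auto
  qed
qed

text \<open>If \<open>e\<close> has a value outside those of \<open>W\<close>, then
  \<open>e'\<close> has 10 hyperarcs against 6 taken. Otherwise the five values on \<open>W\<close>
  contain the at least five hyperarcs of \<open>e\<close>, so both sets agree and \<open>e\<close>
  is tight.\<close>

lemma two_strong_arcs_full:
  assumes h: "ham_cycle V h" "h = W \<union> {e, e'}" and ne: "e \<notin> W" "e' \<notin> W" "e' \<noteq> e"
    and W: "card W = 5" "\<And>e. e \<in> W \<Longrightarrow> card (gens e) \<le> 4"
    and f: "inj_on f W" "\<And>e. e \<in> W \<Longrightarrow> f e \<in> gens e"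
    and e: "5 \<le> card (gens e)" and full: "card (gens e') = 10"
  shows "\<exists>h'. ham_cycle V h' \<and> sdr gens h'"
proof (cases "gens e \<subseteq> f ` W")
  case True
  have finW: "finite W" using W(1) by (simp add: card_ge_0_finite)
  then have "gens e = f ` W"
    using True e W(1) f(1) by (intro card_seteq) (auto simp: card_image)
  then show ?thesis using tight_arc[of h W "fst e" "snd e" e' f] assms by auto
next
  case False
  have finW: "finite W" using W(1) by (simp add: card_ge_0_finite)
  obtain a where a: "a \<in> gens e" "a \<notin> f ` W" using False by blast
  have "card (insert a (f ` W)) \<le> 6"
    using card_insert_le_m1[of 6 "f ` W" a] card_image_le[OF finW, of f] W(1) by simp
  then obtain b where "b \<in> gens e'" "b \<notin> insert a (f ` W)"
    using ex_mem_notin[of "insert a (f ` W)" "gens e'"] full finW by auto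
  then have "sdr gens (W \<union> {e, e'})" using a f by (intro sdr_Un_pair[of f W gens a e b]) auto
  then show ?thesis using h by auto
qed

text \<open>With at least three strong arcs, or none, \<open>h\<close> itself works. With one or
  two, try the reversed cycle: its weak arcs gain at least 6 hyperarcs, so only the reversals of the
  strong arcs need care. If these lack distinct values, nearly all 10 hyperarcs generate the strong
  arcs of \<open>h\<close>, which then suffice or lead to the tight case.\<close>

theorem rainbow_ham_cycle:
  assumes h: "ham_cycle V h" and W: "W \<subseteq> h" "\<And>e. e \<in> W \<Longrightarrow> card (gens e) \<le> 4"
    and f: "inj_on f W" "\<And>e. e \<in> W \<Longrightarrow> f e \<in> gens e"
    and strong: "\<And>e. e \<in> h - W \<Longrightarrow> 5 \<le> card (gens e)"
  shows "\<exists>h'. ham_cycle V h' \<and> sdr gens h'"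
proof -
  have finh: "finite h" using ham_cycle_subset[OF h] finite_V finite_subset by blast
  have finW: "finite W" using W finh finite_subset by blast
  have cW: "card (h - W) + card W = 7"
    using card_ham_cycle[OF h] card_V card_mono[OF finh W(1)] finW W(1)
    by (simp add: card_Diff_subset)
  have conv: "?thesis" if e: "h - W = {e, e'}"
    and ab: "a \<in> gens (prod.swap e)" "b \<in> gens (prod.swap e')" "a \<noteq> b" for e e' a b
  proof -
    have "sdr gens (h\<inverse>)"
    proof (rule sdr_few_weak_pair[OF ham_cycle_converse[OF h] _ ab])
      show "{prod.swap e, prod.swap e'} \<subseteq> h\<inverse>" using e by (cases e; cases e') auto
      fix e0 assume "e0 \<in> h\<inverse> - {prod.swap e, prod.swap e'}"
      moreover obtain x y where xy: "e0 = (x, y)" by (metis surj_pair)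
      ultimately have "(y, x) \<in> h" "(y, x) \<noteq> e" "(y, x) \<noteq> e'" by auto
      then have "(y, x) \<in> W" using e by blast
      then show "5 \<le> card (gens e0)"
        using card_gens_rev[of y x] arc_facts[OF h \<open>(y, x) \<in> h\<close>] W(2) xy by fastforce
    qed
    then show ?thesis using ham_cycle_converse[OF h] by blast
  qed
  have rev: "card (gens e) + card (gens (prod.swap e)) = 10" if "e \<in> h" for e
    using card_gens_rev arc_facts[OF h] that by (metis prod.swap_def surj_pair fst_conv snd_conv)
  consider "card W \<le> 4" | "card (h - W) = 0" | "card (h - W) = 1" | "card (h - W) = 2"
    using cW by linarith
  then show ?thesis
  proof cases
    case 1
    then show ?thesis using sdr_few_weak[OF h W(1) _ f strong] h by blast
  next
    case 2
    then have "h = W" using finh W(1) by auto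
    then show ?thesis using h f unfolding sdr_def by blast
  next
    case 3
    then obtain e where e: "h - W = {e}" by (metis card_1_singletonE)
    \<comment> \<open>Two hyperarcs are asked for because \<open>conv\<close> is used with
      \<open>e' = e\<close>. If they do not exist, \<open>e\<close> has at least 9, more than the 6
      taken by \<open>W\<close>.\<close>
    show ?thesis
    proof (cases "\<exists>a b. a \<in> gens (prod.swap e) \<and> b \<in> gens (prod.swap e) \<and> a \<noteq> b")
      case True
      then show ?thesis using conv[of e e] e by auto
    next
      case False
      then have "card (gens (prod.swap e)) \<le> 1"
        using finite_gens by (auto simp: card_le_Suc0_iff_eq)
      then have "card (f ` W) < card (gens e)"
        using rev[of e] e card_image_le[OF finW, of f] cW 3 by fastforce
      then obtain a where "a \<in> gens e" "a \<notin> f ` W" using ex_mem_notin finW by blast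
      then have "sdr gens (W \<union> {e})"
        using f by (intro sdr_Un[where f = f and g = "\<lambda>_. a"]) auto
      moreover have "W \<union> {e} = h" using e W(1) by blast
      ultimately show ?thesis using h by auto
    qed
  next
    case 4
    then obtain e e' where e: "h - W = {e, e'}" "e \<noteq> e'" by (metis card_2_iff)
    have hW: "h = W \<union> {e, e'}" "h = W \<union> {e', e}" and eW: "e \<notin> W" "e' \<notin> W"
      and eh: "e \<in> h" "e' \<in> h" using e W(1) by auto
    have W5: "card W = 5" using cW 4 by simp
    show ?thesis
    proof (cases "\<exists>a b. a \<in> gens (prod.swap e) \<and> b \<in> gens (prod.swap e') \<and> a \<noteq> b")
      case True
      then show ?thesis using conv[OF e(1)] by blast
    next
      case no: False
      \<comment> \<open>Failure of distinct choices means that one reversal has no hyperarc, so its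
        strong arc has all 10, or that both have at most one, so both strong arcs have at least
        9.\<close>
      consider "gens (prod.swap e') = {}" | "gens (prod.swap e) = {}"
        | "card (gens (prod.swap e)) \<le> 1" "card (gens (prod.swap e')) \<le> 1"
      proof (cases "gens (prod.swap e') = {} \<or> gens (prod.swap e) = {}")
        case False
        then obtain a b where "a \<in> gens (prod.swap e)" "b \<in> gens (prod.swap e')" by blast
        then have "gens (prod.swap e) \<subseteq> {b}" "gens (prod.swap e') \<subseteq> {a}" using no by blast+
        then have "card (gens (prod.swap e)) \<le> 1" "card (gens (prod.swap e')) \<le> 1"
          by (metis card_mono finite.emptyI finite.insertI is_singletonI is_singleton_altdef)+
        then show ?thesis using that by blast
      qed (use that in blast)
      then show ?thesis
      proof cases
        case 1
        then show ?thesis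
          using two_strong_arcs_full[OF h hW(1) eW _ W5 W(2) f] strong[of e] rev[OF eh(2)] e by auto
      next
        case 2
        then show ?thesis
          using two_strong_arcs_full[OF h hW(2) eW(2,1) _ W5 W(2) f] strong[of e'] rev[OF eh(1)] e
          by auto
      next
        case 3
        then have c: "9 \<le> card (gens e)" "9 \<le> card (gens e')"
          using rev[OF eh(1)] rev[OF eh(2)] by linarith+
        have "card (f ` W) \<le> 5" using card_image_le[OF finW, of f] W5 by simp
        then obtain a where a: "a \<in> gens e" "a \<notin> f ` W"
          using ex_mem_notin[of "f ` W" "gens e"] finW c by auto
        have "card (insert a (f ` W)) \<le> 6"
          using \<open>card (f ` W) \<le> 5\<close> finW by (simp add: card_insert_if)
        then obtain b where b: "b \<in> gens e'" "b \<notin> insert a (f ` W)"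
          using ex_mem_notin[of "insert a (f ` W)" "gens e'"] finW c by auto
        have "sdr gens (W \<union> {e, e'})" using a b f by (intro sdr_Un_pair[of f W gens a e b]) auto
        then show ?thesis using h hW by auto
      qed
    qed
  qed
qed

end

section \<open>Cycles with distinct hyperarcs\<close>

text \<open>Unimodality of a row: \<open>k\<close> lies between \<open>j\<close> and
  \<open>m - j\<close>.\<close>

lemma binomial_le_inner:
  assumes "j \<le> k" "k + j \<le> m"
  shows "m choose j \<le> m choose k"
proof (cases "2 * k \<le> m")
  case True
  then show ?thesis using assms by (intro binomial_mono)
next
  case False
  then have "m choose j \<le> m choose (m - k)" using assms by (intro binomial_mono) auto
  then show ?thesis using assms binomial_symmetric[of k m] by simp
qed

section \<open>Precedence within a hyperarc\<close>

lemma precedes_in_set: "precedes u v a \<Longrightarrow> u \<in> set a \<and> v \<in> set a"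
  unfolding precedes_def by auto

lemma precedes_trans:
  assumes "distinct a" "precedes u v a" "precedes v w a"
  shows "precedes u w a"
proof -
  obtain i j where ij: "i < j" "j < length a" "a ! i = u" "a ! j = v"
    using assms(2) unfolding precedes_def by blast
  obtain j' l where jl: "j' < l" "l < length a" "a ! j' = v" "a ! l = w"
    using assms(3) unfolding precedes_def by blast
  have "j = j'" using assms(1) ij jl by (metis less_trans nth_eq_iff_index_eq)
  then have "i < l" using ij jl by simp
  then show ?thesis using ij jl unfolding precedes_def by blast
qed

lemma precedes_irrefl: "distinct a \<Longrightarrow> \<not> precedes u u a"
  unfolding precedes_def by (metis less_irrefl less_trans nth_eq_iff_index_eq)

lemma precedes_asym: "distinct a \<Longrightarrow> precedes u v a \<Longrightarrow> \<not> precedes v u a"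
  using precedes_trans precedes_irrefl by metis

lemma precedes_total:
  assumes "u \<in> set a" "v \<in> set a" "u \<noteq> v"
  shows "precedes u v a \<or> precedes v u a"
proof -
  obtain i j where "i < length a" "a ! i = u" "j < length a" "a ! j = v"
    using assms by (metis in_set_conv_nth)
  then show ?thesis using assms(3) unfolding precedes_def by (metis linorder_neqE_nat)
qed

section \<open>Counting hyperarcs through given vertices\<close>

locale hypertournament =
  fixes V :: "'a set" and A :: "'a list set" and n k :: nat
  assumes card_V: "card V = n" and k_tour: "k_tournament V A k"
    and n7: "7 \<le> n" and k3: "3 \<le> k" and kn: "k + 3 \<le> n"
begin

definition gens :: "'a \<times> 'a \<Rightarrow> 'a list set" where
  "gens e = {a \<in> A. precedes (fst e) (snd e) a}"

definition containing :: "'a set \<Rightarrow> 'a list set" where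
  "containing P = {a \<in> A. P \<subseteq> set a}"

abbreviation N where "N \<equiv> (n - 2) choose (k - 2)"

lemma finite_V: "finite V"
  and A: "a \<in> A \<Longrightarrow> distinct a" "a \<in> A \<Longrightarrow> length a = k" "a \<in> A \<Longrightarrow> set a \<subseteq> V"
  and A_unique: "S \<subseteq> V \<Longrightarrow> card S = k \<Longrightarrow> \<exists>!a. a \<in> A \<and> set a = S"
  using k_tour unfolding k_tournament_def by auto

lemma card_set: "a \<in> A \<Longrightarrow> card (set a) = k"
  using A distinct_card by metis

text \<open>A hyperarc is determined by its vertex set and every \<open>k\<close>-set occurs, so
  removing \<open>P\<close> matches these hyperarcs with the subsets of \<open>V - P\<close> of size
  \<open>k - card P\<close>.\<close>

lemma card_containing:
  assumes P: "P \<subseteq> V" "card P \<le> k"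
  shows "card (containing P) = (n - card P) choose (k - card P)"
proof -
  have finP: "finite P" using P finite_V finite_subset by blast
  have "bij_betw (\<lambda>a. set a - P) (containing P) {T. T \<subseteq> V - P \<and> card T = k - card P}"
    unfolding bij_betw_def
  proof
    show "inj_on (\<lambda>a. set a - P) (containing P)"
    proof (rule inj_onI)
      fix a b assume ab: "a \<in> containing P" "b \<in> containing P" "set a - P = set b - P"
      then have "set a = set b" unfolding containing_def by blast
      then show "a = b" using ab A_unique[of "set a"] A(3) card_set unfolding containing_def by blast
    qed
    show "(\<lambda>a. set a - P) ` containing P = {T. T \<subseteq> V - P \<and> card T = k - card P}"
    proof (intro equalityI subsetI)
      fix T assume "T \<in> (\<lambda>a. set a - P) ` containing P"
      then obtain a where "a \<in> A" "P \<subseteq> set a" "T = set a - P" unfolding containing_def by blast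
      then show "T \<in> {T. T \<subseteq> V - P \<and> card T = k - card P}"
        using A(3)[of a] card_set[of a] finP by (auto simp: card_Diff_subset)
    next
      fix T assume "T \<in> {T. T \<subseteq> V - P \<and> card T = k - card P}"
      then have T: "T \<subseteq> V - P" "card T = k - card P" by auto
      have "finite T" using T(1) finite_V by (meson finite_Diff finite_subset)
      then have "card (T \<union> P) = k"
        using T P finP by (subst card_Un_disjoint) auto
      then obtain a where a: "a \<in> A" "set a = T \<union> P"
        using A_unique[of "T \<union> P"] T(1) P(1) by blast
      then have "a \<in> containing P" "T = set a - P" unfolding containing_def using T(1) by auto
      then show "T \<in> (\<lambda>a. set a - P) ` containing P" by blast
    qed
  qed
  then have "card (containing P) = card {T. T \<subseteq> V - P \<and> card T = k - card P}"
    by (rule bij_betw_same_card)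
  also have "\<dots> = (n - card P) choose (k - card P)"
    using finite_V P finP card_V by (simp add: n_subsets card_Diff_subset)
  finally show ?thesis .
qed

lemma finite_containing: "finite (containing P)"
proof -
  have "A \<subseteq> {xs. set xs \<subseteq> V \<and> length xs = k}" using A by blast
  then have "finite A" using finite_lists_length_eq[OF finite_V] finite_subset by blast
  then show ?thesis unfolding containing_def by simp
qed

lemma gens_subset_containing: "gens (u, v) \<subseteq> containing {u, v}"
  by (auto simp: gens_def containing_def dest: precedes_in_set)

lemma finite_gens: "finite (gens e)"
  using gens_subset_containing finite_containing by (metis finite_subset surj_pair)

lemma gens_disjoint: "gens (u, v) \<inter> gens (v, u) = {}"
  by (auto simp: gens_def dest: precedes_asym[OF A(1)])

lemma gens_trans: "a \<in> gens (u, v) \<Longrightarrow> a \<in> gens (v, w) \<Longrightarrow> a \<in> gens (u, w)"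
  by (auto simp: gens_def intro: precedes_trans[OF A(1)])

lemma gens_Un: "u \<noteq> v \<Longrightarrow> gens (u, v) \<union> gens (v, u) = containing {u, v}"
  by (auto simp: gens_def containing_def dest: precedes_in_set precedes_total)

lemma gens_arc: "a \<in> gens (u, v) \<Longrightarrow> u \<in> V \<and> v \<in> V \<and> u \<noteq> v"
  using A(1,3)[of a] precedes_in_set[of u v a] precedes_irrefl[of a u] by (auto simp: gens_def)

lemma card_containing_pair: "u \<in> V \<Longrightarrow> v \<in> V \<Longrightarrow> u \<noteq> v \<Longrightarrow> card (containing {u, v}) = N"
  using card_containing[of "{u, v}"] k3 by (simp add: numeral_2_eq_2)

lemma card_gens_rev: "u \<in> V \<Longrightarrow> v \<in> V \<Longrightarrow> u \<noteq> v \<Longrightarrow> card (gens (u, v)) + card (gens (v, u)) = N"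
  using card_containing_pair[of u v] gens_Un[of u v] card_Un_disjoint[OF finite_gens finite_gens gens_disjoint, of u v]
  by simp

text \<open>Different pairs have at least three vertices between them, all in any hyperarc that
  contains both.\<close>

lemma card_containing_share:
  assumes "p \<subseteq> V" "p' \<subseteq> V" "card p = 2" "card p' = 2" "p \<noteq> p'"
  shows "card (containing p \<inter> containing p') \<le> (n - 3) choose (k - 3)"
proof -
  have fin: "finite p" "finite p'" using assms finite_V finite_subset by blast+
  have "\<not> p' \<subseteq> p" using card_seteq[of p p'] fin assms by auto
  then obtain x where x: "x \<in> p'" "x \<notin> p" by blast
  have "card (containing p \<inter> containing p') \<le> card (containing (insert x p))"
    using x by (intro card_mono finite_containing) (auto simp: containing_def)
  also have "\<dots> = (n - 3) choose (k - 3)"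
    using card_containing[of "insert x p"] x assms fin k3 by auto
  finally show ?thesis .
qed

text \<open>\<open>W\<close> collects the cycle arcs below the threshold. They stem from the path,
  whose hyperarcs are distinct, so they have distinct values however few hyperarcs generate
  them.\<close>

lemma strong_ham_cycle:
  assumes strong: "strong_hyper V A" and t: "2 * t \<le> N + 1"
  obtains h W f where "ham_cycle V h" "W \<subseteq> h" "inj_on f W"
    "\<And>e. e \<in> W \<Longrightarrow> f e \<in> gens e \<and> card (gens e) < t" "\<And>e. e \<in> h - W \<Longrightarrow> t \<le> card (gens e)"
proof -
  define D where "D = {(u, v). u \<in> V \<and> v \<in> V \<and> u \<noteq> v \<and> t \<le> card (gens (u, v))}"
  have DV: "D \<subseteq> V \<times> V" unfolding D_def by auto
  \<comment> \<open>If both orientations were missing from \<open>D\<close>, then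
    \<open>N \<le> 2 * (t - 1)\<close>, against the choice of \<open>t\<close>.\<close>
  have semi: "(u, v) \<in> D \<or> (v, u) \<in> D" if "u \<in> V" "v \<in> V" "u \<noteq> v" for u v
    using card_gens_rev[OF that] t that unfolding D_def by auto
  have V: "V \<noteq> {}" using card_V n7 by auto
  obtain z where z: "z \<in> V" "\<And>x. x \<in> V \<Longrightarrow> (x, z) \<in> D\<^sup>*"
    using semicomplete_sink[OF finite_V V DV semi] by blast
  obtain s where s: "s \<in> V" "\<And>x. x \<in> V \<Longrightarrow> (s, x) \<in> D\<^sup>*"
    using semicomplete_source[OF finite_V V DV semi] by blast
  have "\<exists>P f. P \<subseteq> V \<times> V \<and> (z, s) \<in> P\<^sup>* \<and> inj_on f P \<and> (\<forall>e\<in>P. f e \<in> gens e)"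
  proof (cases "z = s")
    case True
    then show ?thesis by (intro exI[of _ "{}"]) auto
  next
    case False
    then obtain xs as where path: "hpath A xs as z s"
      using strong z(1) s(1) unfolding strong_hyper_def by blast
    then have len: "length as + 1 = length xs" and dx: "distinct xs" and da: "distinct as"
      and ends: "xs \<noteq> []" "hd xs = z" "last xs = s"
      and arc: "\<And>i. i < length as \<Longrightarrow> as ! i \<in> gens (xs ! i, xs ! Suc i)"
      unfolding hpath_def gens_def by auto
    define e where "e i = (xs ! i, xs ! Suc i)" for i
    have inje: "inj_on e {..<length as}"
      using dx len unfolding e_def inj_on_def by (auto simp: nth_eq_iff_index_eq)
    define P where "P = e ` {..<length as}"
    have "(z, xs ! i) \<in> P\<^sup>*" if "i \<le> length as" for i
      using that
    proof (induction i)
      case 0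
      then show ?case using ends by (simp add: hd_conv_nth)
    next
      case (Suc i)
      then have "(xs ! i, xs ! Suc i) \<in> P" unfolding P_def e_def by auto
      then show ?case using Suc by (meson Suc_leD rtrancl.rtrancl_into_rtrancl)
    qed
    moreover have "s = xs ! length as" using ends len by (metis add_diff_cancel_right' last_conv_nth)
    ultimately have "(z, s) \<in> P\<^sup>*" by simp
    moreover have "P \<subseteq> V \<times> V" using arc gens_arc unfolding P_def e_def by blast
    \<comment> \<open>Each arc of \<open>P\<close> has one position on the path because the vertices
      are distinct; different positions carry different hyperarcs.\<close>
    moreover have "inj_on (\<lambda>x. as ! inv_into {..<length as} e x) P"
    proof (rule inj_onI)
      fix x y assume xy: "x \<in> P" "y \<in> P"
        and "as ! inv_into {..<length as} e x = as ! inv_into {..<length as} e y"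
      moreover have "inv_into {..<length as} e x < length as" "inv_into {..<length as} e y < length as"
        using inv_into_into[of _ e "{..<length as}"] xy unfolding P_def by blast+
      ultimately have "inv_into {..<length as} e x = inv_into {..<length as} e y"
        using da by (simp add: nth_eq_iff_index_eq)
      then show "x = y" using xy unfolding P_def by (rule inv_into_injective)
    qed
    moreover have "\<forall>x\<in>P. as ! inv_into {..<length as} e x \<in> gens x"
    proof
      fix x assume "x \<in> P"
      then obtain i where i: "i < length as" "x = e i" unfolding P_def by blast
      then have "inv_into {..<length as} e x = i" using inje by (simp add: inv_into_f_f)
      then show "as ! inv_into {..<length as} e x \<in> gens x" using arc[OF i(1)] i(2) by (simp add: e_def)
    qed
    ultimately show ?thesis by blast
  qed
  then obtain P f where P: "P \<subseteq> V \<times> V" "(z, s) \<in> P\<^sup>*" and f: "inj_on f P" "\<And>e. e \<in> P \<Longrightarrow> f e \<in> gens e"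
    by blast
  have "\<exists>h \<subseteq> D \<union> P. ham_cycle V h"
  proof (rule strong_semicomplete_ham_cycle[OF finite_V])
    show "2 \<le> card V" using card_V n7 by simp
    show "D \<union> P \<subseteq> V \<times> V" using DV P by blast
    show "(u, v) \<in> D \<union> P \<or> (v, u) \<in> D \<union> P" if "u \<in> V" "v \<in> V" "u \<noteq> v" for u v
      using semi[OF that] by blast
    have mono: "D\<^sup>* \<subseteq> (D \<union> P)\<^sup>*" "P\<^sup>* \<subseteq> (D \<union> P)\<^sup>*" by (simp_all add: rtrancl_mono)
    show "(u, v) \<in> (D \<union> P)\<^sup>*" if "u \<in> V" "v \<in> V" for u v
    proof -
      have "(u, z) \<in> (D \<union> P)\<^sup>*" "(z, s) \<in> (D \<union> P)\<^sup>*" "(s, v) \<in> (D \<union> P)\<^sup>*"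
        using z(2)[OF that(1)] P(2) s(2)[OF that(2)] mono by blast+
      then show ?thesis by (meson rtrancl_trans)
    qed
  qed
  then obtain h where h: "h \<subseteq> D \<union> P" "ham_cycle V h" by blast
  show thesis
  proof (rule that[OF h(2)])
    show "h - D \<subseteq> h" by blast
    show "inj_on f (h - D)" using h(1) by (intro inj_on_subset[OF f(1)]) auto
    fix e
    show "f e \<in> gens e \<and> card (gens e) < t" if "e \<in> h - D"
    proof -
      have "e \<in> P" "e \<notin> D" using that h(1) by auto
      moreover obtain u v where "e = (u, v)" by (metis surj_pair)
      ultimately show ?thesis using f(2)[of e] gens_arc[of "f e" u v] unfolding D_def by auto
    qed
    show "t \<le> card (gens e)" if "e \<in> h - (h - D)" using that unfolding D_def by auto
  qed
qed

section \<open>Assigning hyperarcs to the cycle\<close>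

lemma arc_facts:
  assumes "ham_cycle V h" "(u, v) \<in> h"
  shows "u \<in> V" "v \<in> V" "u \<noteq> v" "(v, u) \<notin> h"
  using assms ham_cycle_subset[OF assms(1)] ham_cycle_irrefl[OF assms(1)]
    ham_cycle_asym[OF assms(1) _ assms(2)] card_V n7 by auto

lemma card_arcs: "ham_cycle V h \<Longrightarrow> card h = n"
  using card_ham_cycle card_V by blast

lemma finite_arcs: "ham_cycle V h \<Longrightarrow> finite h"
  using card_arcs n7 by (metis card.infinite not_numeral_le_zero)

text \<open>\<open>N\<close> is at least \<open>(n - 2) choose 2\<close>, its value at
  \<open>k = 4\<close>. Equality holds for \<open>n = 8\<close>, \<open>k = 4\<close>, where
  \<open>N = 15\<close>; for \<open>n = 7\<close>, \<open>k = 4\<close> the bound fails with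
  \<open>N = 10\<close>, which forces a separate treatment.\<close>

lemma N_large: "4 \<le> k \<Longrightarrow> 8 \<le> n \<Longrightarrow> 2 * n \<le> N + 1"
proof -
  assume *: "4 \<le> k" "8 \<le> n"
  obtain m where m: "n = m + 8" using *(2) by (metis le_add_diff_inverse2)
  have "(n - 2) choose 2 \<le> N" using * kn by (intro binomial_le_inner) auto
  moreover have "2 * ((n - 2) choose 2) = (m + 6) * (m + 5)"
    using m by (simp add: choose_two algebra_simps)
  moreover have "(m + 6) * (m + 5) = m * m + 11 * m + 30" by (simp add: algebra_simps)
  ultimately have "m * m + 11 * m + 30 \<le> 2 * N" by linarith
  then show ?thesis using m by (simp add: algebra_simps)
qed

text \<open>One strong arc in \<open>S\<close> already has \<open>n\<close> hyperarcs; the values on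
  \<open>W\<close> remove at most \<open>card W\<close> of them, and
  \<open>card S + card W \<le> n\<close>.\<close>

lemma rainbow_ham_cycle_large:
  assumes strong: "strong_hyper V A" and "4 \<le> k" "8 \<le> n"
  shows "\<exists>h. ham_cycle V h \<and> sdr gens h"
proof -
  obtain h W f where h: "ham_cycle V h" and W: "W \<subseteq> h" and f: "inj_on f W"
    "\<And>e. e \<in> W \<Longrightarrow> f e \<in> gens e \<and> card (gens e) < n" and st: "\<And>e. e \<in> h - W \<Longrightarrow> n \<le> card (gens e)"
    using strong_ham_cycle[OF strong, of n] N_large[OF assms(2,3)] by metis
  have finh: "finite h" and finW: "finite W" using finite_arcs[OF h] W finite_subset by blast+
  have "sdr gens (W \<union> (h - W))"
  proof (rule Hall_extend[OF f(1)])
    show "f e \<in> gens e" if "e \<in> W" for e using f(2) that by blast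
    show "finite (h - W)" using finh by blast
    show "finite (gens e)" for e by (rule finite_gens)
    fix S assume S: "S \<subseteq> h - W"
    have finS: "finite S" using S finh finite_subset by blast
    show "card S \<le> card (\<Union>(gens ` S) - f ` W)"
    proof (cases "S = {}")
      case False
      then obtain e where e: "e \<in> S" by blast
      have "n \<le> card (gens e)" using st S e by blast
      also have "\<dots> \<le> card (\<Union>(gens ` S))" using e finS finite_gens by (intro card_mono) auto
      finally have 1: "n \<le> card (\<Union>(gens ` S))" .
      have "card (S \<union> W) \<le> card h" using S W finh by (intro card_mono) auto
      then have "card S + card W \<le> n"
        using S finS finW card_arcs[OF h] by (subst (asm) card_Un_disjoint) auto
      moreover have "card (\<Union>(gens ` S)) - card W \<le> card (\<Union>(gens ` S) - f ` W)"
        using diff_card_le_card_Diff[of "f ` W" "\<Union>(gens ` S)"] card_image_le[OF finW, of f] finW by simp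
      ultimately show ?thesis using 1 by linarith
    qed simp
  qed
  moreover have "W \<union> (h - W) = h" using W by blast
  ultimately show ?thesis using h by auto
qed

text \<open>For \<open>k = 3\<close>, a triple containing the arc \<open>(x, y)\<close> of the cycle contains another arc of the cycle only
  if its third vertex is the predecessor of \<open>x\<close> or the successor of \<open>y\<close>.
  Hence each of the strong arcs has a hyperarc that no other arc competes for.\<close>

lemma rainbow_ham_cycle_3:
  assumes strong: "strong_hyper V A" and k: "k = 3"
  shows "\<exists>h. ham_cycle V h \<and> sdr gens h"
proof -
  \<comment> \<open>Two triples on a strong arc can be contested, so threshold 3 leaves one. It is
    admissible since \<open>N = n - 2\<close> is at least 5.\<close>
  have "2 * 3 \<le> N + 1" using k n7 by simp
  then obtain h W f where h: "ham_cycle V h" and W: "W \<subseteq> h" and f: "inj_on f W"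
    "\<And>e. e \<in> W \<Longrightarrow> f e \<in> gens e \<and> card (gens e) < 3" and st: "\<And>e. e \<in> h - W \<Longrightarrow> 3 \<le> card (gens e)"
    using strong_ham_cycle[OF strong, of 3] by metis
  note su = ham_cycle_succ_unique[OF h] and pre = ham_cycle_pred_unique[OF h]
  have "\<exists>a. a \<in> gens e \<and> (\<forall>e'\<in>h. a \<in> gens e' \<longrightarrow> e' = e)" if e: "e \<in> h - W" for e
  proof -
    obtain x y where xy: "e = (x, y)" by (metis surj_pair)
    have xyh: "(x, y) \<in> h" using e xy by blast
    note xyV = arc_facts[OF h xyh]
    obtain p where p: "(p, x) \<in> h" using ham_cycle_pred[OF h xyV(1)] by blast
    obtain q where q: "(y, q) \<in> h" using ham_cycle_succ[OF h xyV(2)] by blast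
    note pV = arc_facts[OF h p] and qV = arc_facts[OF h q]
    have "card {p, x, y} = 3" "card {x, y, q} = 3" using xyV p q pV qV by (auto simp: card_insert_if)
    then have "card (containing {p, x, y}) = 1" "card (containing {x, y, q}) = 1"
      using card_containing[of "{p, x, y}"] card_containing[of "{x, y, q}"] xyV pV qV k by auto
    then have "card (containing {p, x, y} \<union> containing {x, y, q}) \<le> 2"
      using card_Un_le[of "containing {p, x, y}" "containing {x, y, q}"] by simp
    then have "card (containing {p, x, y} \<union> containing {x, y, q}) < card (gens e)" using st[OF e] by simp
    then obtain a where a: "a \<in> gens e" "a \<notin> containing {p, x, y} \<union> containing {x, y, q}"
      using ex_mem_notin finite_containing finite_UnI by metis
    have aA: "a \<in> A" and axy: "x \<in> set a" "y \<in> set a"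
      using a(1) xy precedes_in_set[of x y a] unfolding gens_def by auto
    have "e' = e" if e': "e' \<in> h" "a \<in> gens e'" for e'
    proof (rule ccontr)
      assume ne: "e' \<noteq> e"
      obtain u v where uv: "e' = (u, v)" by (metis surj_pair)
      have auv: "u \<in> set a" "v \<in> set a" using e'(2) uv precedes_in_set[of u v a] unfolding gens_def by auto
      have uvh: "(u, v) \<in> h" using e' uv by blast
      have pq: "p \<notin> set a" "q \<notin> set a" using a(2) aA axy unfolding containing_def by auto
      have "u \<noteq> x" "v \<noteq> y" using su[OF uvh] pre[OF uvh] xyh ne uv xy by auto
      moreover have "v \<noteq> x" "u \<noteq> y" using pre[OF uvh] p su[OF uvh] q auv pq by auto
      ultimately have "card {x, y, u, v} = 4"
        using xyV arc_facts[OF h uvh] by (auto simp: card_insert_if)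
      moreover have "card {x, y, u, v} \<le> card (set a)" using axy auv by (intro card_mono) auto
      ultimately show False using card_set[OF aA] k by simp
    qed
    then show ?thesis using a by blast
  qed
  then obtain g where g: "\<And>e. e \<in> h - W \<Longrightarrow> g e \<in> gens e \<and> (\<forall>e'\<in>h. g e \<in> gens e' \<longrightarrow> e' = e)"
    by metis
  have "sdr gens (W \<union> (h - W))"
  proof (rule sdr_Un[OF f(1)])
    show "f e \<in> gens e" if "e \<in> W" for e using f(2) that by blast
    show "inj_on g (h - W)" using g by (intro inj_onI) (metis DiffD1)
    show "g e \<in> gens e" if "e \<in> h - W" for e using g that by blast
    show "f e \<noteq> g e'" if "e \<in> W" "e' \<in> h - W - W" for e e'
      using that f(2)[of e] g[of e'] W by (metis DiffD1 DiffD2 subsetD)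
  qed
  moreover have "W \<union> (h - W) = h" using W by blast
  ultimately show ?thesis using h by auto
qed

text \<open>The constants of the abstract setting: a pair lies in \<open>5 choose 2 = 10\<close>
  hyperarcs, two different pairs share at most \<open>4 choose 1 = 4\<close>, two disjoint pairs
  only the one on their four vertices. The largest threshold that \<open>N = 10\<close> allows is
  5.\<close>

lemma rainbow_ham_cycle_7_4:
  assumes strong: "strong_hyper V A" and nk: "n = 7" "k = 4"
  shows "\<exists>h. ham_cycle V h \<and> sdr gens h"
proof -
  have N10: "N = 10" using nk by (simp add: choose_two)
  interpret S: seven_four V gens
  proof
    fix u v x y
    assume *: "{u, v, x, y} \<subseteq> V" "u \<noteq> v" "x \<noteq> y"
    have sub: "card (gens (u, v) \<inter> gens (x, y)) \<le> card (containing {u, v} \<inter> containing {x, y})"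
      using gens_subset_containing[of u v] gens_subset_containing[of x y] finite_containing by (intro card_mono) auto
    show "card (gens (u, v) \<inter> gens (x, y)) \<le> 4" if "{u, v} \<noteq> {x, y}"
      using sub card_containing_share[of "{u, v}" "{x, y}"] * that nk by simp
    show "card (gens (u, v) \<inter> gens (x, y)) \<le> 1" if "{u, v} \<inter> {x, y} = {}"
    proof -
      have "card {u, v, x, y} = 4" using * that by (auto simp: card_insert_if)
      then have "card (containing {u, v, x, y}) = 1" using card_containing[of "{u, v, x, y}"] * nk by simp
      moreover have "containing {u, v, x, y} = containing {u, v} \<inter> containing {x, y}" unfolding containing_def by auto
      ultimately show ?thesis using sub by simp
    qed
  qed (use card_V nk finite_gens gens_disjoint gens_trans gens_Un card_containing_pair N10 in auto)
  obtain h W f where h: "ham_cycle V h" and W: "W \<subseteq> h" and f: "inj_on f W"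
    "\<And>e. e \<in> W \<Longrightarrow> f e \<in> gens e \<and> card (gens e) < 5" and st: "\<And>e. e \<in> h - W \<Longrightarrow> 5 \<le> card (gens e)"
    using strong_ham_cycle[OF strong, of 5] N10 by auto
  show ?thesis
    by (rule S.rainbow_ham_cycle[OF h W _ f(1) _ st]) (use f(2) in fastforce)+
qed

theorem rainbow_ham_cycle:
  assumes "strong_hyper V A"
  shows "\<exists>h. ham_cycle V h \<and> sdr gens h"
proof -
  consider "k = 3" | "4 \<le> k" "8 \<le> n" | "n = 7" "k = 4" using k3 kn n7 by linarith
  then show ?thesis
    using assms rainbow_ham_cycle_3 rainbow_ham_cycle_large rainbow_ham_cycle_7_4 by cases blast+
qed

end

section \<open>Extension to a tournament\<close>

lemma double_count:
  assumes "finite S" "finite X"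
  shows "(\<Sum>p\<in>S. card {a \<in> X. R p a}) = (\<Sum>a\<in>X. card {p \<in> S. R p a})"
  using assms by (intro sum_multicount_gen) auto

context hypertournament
begin

definition free_pairs :: "('a \<times> 'a) set \<Rightarrow> 'a set set" where
  "free_pairs h = {p. p \<subseteq> V \<and> card p = 2 \<and> (\<forall>(u, v)\<in>h. p \<noteq> {u, v})}"

lemma finite_free_pairs: "finite (free_pairs h)"
  by (rule finite_subset[of _ "Pow V"]) (use finite_V in \<open>auto simp: free_pairs_def\<close>)

lemma card_containing_free: "p \<in> free_pairs h \<Longrightarrow> card (containing p) = N"
  using card_containing[of p] k3 unfolding free_pairs_def by simp

lemma card_2_subsets: "a \<in> A \<Longrightarrow> card {p. p \<subseteq> set a \<and> card p = 2} = k choose 2"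
  using n_subsets[of "set a" 2] card_set by simp

lemma card_Un_containing:
  assumes "p \<in> free_pairs h" "p' \<in> free_pairs h" "p \<noteq> p'"
  shows "2 * N \<le> card (containing p \<union> containing p') + ((n - 3) choose (k - 3))"
proof -
  have "card (containing p) + card (containing p') = card (containing p \<union> containing p') + card (containing p \<inter> containing p')"
    by (rule card_Un_Int) (rule finite_containing)+
  moreover have "card (containing p \<inter> containing p') \<le> (n - 3) choose (k - 3)"
    using assms by (intro card_containing_share) (auto simp: free_pairs_def)
  ultimately show ?thesis using card_containing_free assms by simp
qed

text \<open>A free pair is oriented as its assigned hyperarc lists it, so that hyperarc generates
  the resulting arc automatically.\<close>

lemma extend_rainbow:
  assumes h: "ham_cycle V h" and f: "inj_on f h" "\<And>e. e \<in> h \<Longrightarrow> f e \<in> gens e"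
    and hall: "\<And>S. S \<subseteq> free_pairs h \<Longrightarrow> S \<noteq> {} \<Longrightarrow> card S \<le> card (\<Union>(containing ` S) - f ` h)"
  shows "\<exists>T \<in> gen_tournaments V A. strong_tournament V T"
proof -
  have "sdr (\<lambda>p. containing p - f ` h) (free_pairs h)"
  proof (rule Hall[OF finite_free_pairs])
    show "finite (containing p - f ` h)" for p using finite_containing by blast
    fix S assume S: "S \<subseteq> free_pairs h"
    have "\<Union>((\<lambda>p. containing p - f ` h) ` S) = \<Union>(containing ` S) - f ` h" by auto
    then show "card S \<le> card (\<Union>((\<lambda>p. containing p - f ` h) ` S))"
      using hall[OF S] by (cases "S = {}") auto
  qed
  then obtain g where g: "inj_on g (free_pairs h)"
    "\<And>p. p \<in> free_pairs h \<Longrightarrow> g p \<in> containing p" "\<And>p. p \<in> free_pairs h \<Longrightarrow> g p \<notin> f ` h"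
    unfolding sdr_def by auto
  define T where "T = h \<union> {(u, v). {u, v} \<in> free_pairs h \<and> precedes u v (g {u, v})}"
  have TV: "T \<subseteq> V \<times> V" unfolding T_def free_pairs_def using ham_cycle_subset[OF h] by auto
  have irr: "(x, x) \<notin> T" for x
    unfolding T_def free_pairs_def using arc_facts(3)[OF h, of x x] by auto
  have not_free: "{u, v} \<notin> free_pairs h" "{v, u} \<notin> free_pairs h" if "(u, v) \<in> h" for u v
    using that unfolding free_pairs_def by (auto simp: insert_commute)
  have dist: "distinct (g p)" "p \<subseteq> set (g p)" "g p \<in> A" if "p \<in> free_pairs h" for p
    using g(2)[OF that] A(1) unfolding containing_def by auto
  have tour: "(u, v) \<in> T \<longleftrightarrow> (v, u) \<notin> T" if uv: "u \<in> V" "v \<in> V" "u \<noteq> v" for u v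
  proof (cases "(u, v) \<in> h \<or> (v, u) \<in> h")
    case True
    then show ?thesis
      using not_free[of u v] not_free[of v u] arc_facts(4)[OF h, of u v] arc_facts(4)[OF h, of v u]
      unfolding T_def by auto
  next
    case False
    have "card {u, v} = 2" using uv by simp
    moreover have "{u, v} \<noteq> {x, y}" if "(x, y) \<in> h" for x y
      using that False by (auto simp: doubleton_eq_iff)
    ultimately have free: "{u, v} \<in> free_pairs h" using uv unfolding free_pairs_def by auto
    have "precedes u v (g {u, v}) \<longleftrightarrow> \<not> precedes v u (g {u, v})"
      using dist(2)[OF free] precedes_asym[OF dist(1)[OF free], of u v]
        precedes_total[of u "g {u, v}" v] uv(3) by auto
    then show ?thesis using False free unfolding T_def by (auto simp: insert_commute)
  qed
  have tournament: "tournament V T" unfolding tournament_def using TV irr tour by blast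
  define F where "F e = (if e \<in> h then f e else g {fst e, snd e})" for e
  have Th: "{fst e, snd e} \<in> free_pairs h" "precedes (fst e) (snd e) (g {fst e, snd e})"
    if "e \<in> T" "e \<notin> h" for e
    using that unfolding T_def by auto
  have "generated_by A T"
    unfolding generated_by_def
  proof (intro exI conjI)
    show "inj_on F T"
    proof (rule inj_onI)
      fix e e' assume e: "e \<in> T" "e' \<in> T" and eq: "F e = F e'"
      consider "e \<in> h" "e' \<in> h" | "e \<in> h" "e' \<notin> h" | "e \<notin> h" "e' \<in> h" | "e \<notin> h" "e' \<notin> h" by blast
      then show "e = e'"
      proof cases
        case 1
        then show ?thesis using eq f(1) by (simp add: F_def inj_on_eq_iff)
      next
        case 2
        then show ?thesis using eq g(3)[OF Th(1)[OF e(2)]] imageI[of e h f] by (simp add: F_def)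
      next
        case 3
        then show ?thesis using eq g(3)[OF Th(1)[OF e(1)]] imageI[of e' h f] by (simp add: F_def)
      next
        case 4
        then have "{fst e, snd e} = {fst e', snd e'}"
          using eq g(1) Th(1) e by (simp add: F_def inj_on_eq_iff)
        then have "e = e' \<or> e = (snd e', fst e')" by (auto simp: doubleton_eq_iff prod_eq_iff)
        then show ?thesis using tour e TV irr by (metis mem_Sigma_iff prod.collapse subsetD)
      qed
    qed
    show "\<forall>(u, v)\<in>T. F (u, v) \<in> A \<and> precedes u v (F (u, v))"
    proof clarify
      fix u v assume uv: "(u, v) \<in> T"
      show "F (u, v) \<in> A \<and> precedes u v (F (u, v))"
      proof (cases "(u, v) \<in> h")
        case True
        then show ?thesis using f(2)[of "(u, v)"] by (simp add: F_def gens_def)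
      next
        case False
        then show ?thesis using Th[OF uv False] dist(3)[of "{u, v}"] by (simp add: F_def)
      qed
    qed
  qed
  moreover have "(u, v) \<in> T\<^sup>+" if "u \<in> V" "v \<in> V" for u v
    using ham_cycle_trancl[OF h that] trancl_mono[of _ h T] unfolding T_def by blast
  ultimately show ?thesis
    using tournament unfolding gen_tournaments_def strong_tournament_def by blast
qed

section \<open>Hall's condition for the pairs off the cycle\<close>

lemma card_Diff_arcs:
  assumes "ham_cycle V h" "finite X"
  shows "card X - n \<le> card (X - f ` h)"
  using diff_card_le_card_Diff[of "f ` h" X] card_image_le[OF finite_arcs[OF assms(1)], of f]
    card_arcs[OF assms(1)] finite_arcs[OF assms(1)] by simp

text \<open>Both sides count incidences of pairs in \<open>S\<close> with hyperarcs; each pair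
  contributes \<open>N\<close>.\<close>

lemma containing_double_count:
  assumes S: "S \<subseteq> free_pairs h"
  shows "N * card S = (\<Sum>a\<in>\<Union>(containing ` S). card {p \<in> S. p \<subseteq> set a})"
proof -
  have finS: "finite S" using S finite_free_pairs finite_subset by blast
  have "{a \<in> \<Union>(containing ` S). p \<subseteq> set a} = containing p" if "p \<in> S" for p
    using that unfolding containing_def by auto
  then have "(\<Sum>p\<in>S. card {a \<in> \<Union>(containing ` S). p \<subseteq> set a}) = (\<Sum>p\<in>S. N)"
    using S card_containing_free by (intro sum.cong) auto
  then show ?thesis
    using double_count[of S "\<Union>(containing ` S)" "\<lambda>p a. p \<subseteq> set a"] finS finite_containing
    by (simp add: mult.commute)
qed

lemma free_pairs_in_hyperarc:
  assumes "S \<subseteq> free_pairs h" "a \<in> A"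
  shows "{p \<in> S. p \<subseteq> set a} \<subseteq> {p. p \<subseteq> set a \<and> card p = 2}"
  using assms unfolding free_pairs_def by auto

lemma card_free_pairs_in_hyperarc:
  assumes "S \<subseteq> free_pairs h" "a \<in> A"
  shows "card {p \<in> S. p \<subseteq> set a} \<le> k choose 2"
proof -
  have "card {p \<in> S. p \<subseteq> set a} \<le> card {p. p \<subseteq> set a \<and> card p = 2}"
    by (rule card_mono[OF _ free_pairs_in_hyperarc[OF assms]]) simp
  then show ?thesis using card_2_subsets[OF assms(2)] by simp
qed

lemma N_card_le:
  assumes S: "S \<subseteq> free_pairs h"
  shows "N * card S \<le> (k choose 2) * card (\<Union>(containing ` S))"
proof -
  have "(\<Sum>a\<in>\<Union>(containing ` S). card {p \<in> S. p \<subseteq> set a}) \<le> (\<Sum>a\<in>\<Union>(containing ` S). k choose 2)"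
    by (intro sum_mono card_free_pairs_in_hyperarc[OF S]) (auto simp: containing_def)
  then show ?thesis using containing_double_count[OF S] by (simp add: mult.commute)
qed

text \<open>\<open>N / (k choose 2)\<close> equals \<open>(n choose k) / (n choose 2)\<close>, by
  counting pairs inside \<open>k\<close>-sets. Since \<open>n choose k\<close> is unimodal and
  \<open>3 \<le> k \<le> n - 3\<close>, this is smallest at \<open>k = 3\<close>, where it is
  \<open>(n - 2) / 3\<close>.\<close>

lemma N_ge: "(n - 2) * (k choose 2) \<le> 3 * N"
proof -
  have "(n choose k) * (k choose 2) = (n choose 2) * N" using choose_mult[of 2 k n] k3 kn by simp
  moreover have "(n choose 3) * (3 choose 2) = (n choose 2) * ((n - 2) choose (3 - 2))"
    using choose_mult[of 2 3 n] n7 by simp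
  moreover have "n choose 3 \<le> n choose k" using k3 kn by (intro binomial_le_inner) auto
  moreover have "(3::nat) choose 2 = 3" by (simp add: choose_two)
  ultimately have n3: "3 * (n choose 3) = (n choose 2) * (n - 2)"
    and nk: "n choose 3 \<le> n choose k" "(n choose k) * (k choose 2) = (n choose 2) * N" by auto
  have "(n choose 2) * ((n - 2) * (k choose 2)) = 3 * (n choose 3) * (k choose 2)"
    using n3 by (simp add: mult.assoc)
  also have "\<dots> \<le> 3 * (n choose k) * (k choose 2)" using nk(1) by simp
  also have "\<dots> = (n choose 2) * (3 * N)" using nk(2) by (simp add: mult.assoc mult.left_commute)
  finally have "(n choose 2) * ((n - 2) * (k choose 2)) \<le> (n choose 2) * (3 * N)" .
  moreover have "0 < n choose 2" using n7 by simp
  ultimately show ?thesis by simp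
qed

lemma hall_large:
  assumes h: "ham_cycle V h" and k4: "4 \<le> k" and n8: "8 \<le> n"
    and S: "S \<subseteq> free_pairs h" "S \<noteq> {}"
  shows "card S \<le> card (\<Union>(containing ` S) - f ` h)"
proof -
  have finS: "finite S" using S finite_free_pairs finite_subset by blast
  let ?X = "\<Union>(containing ` S)"
  have finX: "finite ?X" using finS finite_containing by blast
  obtain p where p: "p \<in> S" using S by blast
  have "card (containing p) \<le> card ?X" using p finX by (intro card_mono) auto
  then have NX: "N \<le> card ?X" using card_containing_free S(1) p by auto
  \<comment> \<open>Up to 7 pairs, one of them suffices, as
    \<open>N \<ge> 2 * n - 1 \<ge> n + 7\<close>. From 8 on, \<open>card ?X\<close> is at least
    \<open>(n - 2) / 3\<close> times \<open>card S\<close>, which for \<open>n = 8\<close> means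
    \<open>2 * card S \<ge> card S + 8\<close>, with equality at 8.\<close>
  have "card S + n \<le> card ?X"
  proof (cases "card S \<le> 7")
    case True
    then show ?thesis using NX N_large[OF k4 n8] n8 by linarith
  next
    case False
    have "(k choose 2) * ((n - 2) * card S) \<le> 3 * (N * card S)"
      using mult_right_mono[OF N_ge, of "card S"] by (simp add: algebra_simps)
    also have "\<dots> \<le> (k choose 2) * (3 * card ?X)" using N_card_le[OF S(1)] by simp
    finally have 1: "(n - 2) * card S \<le> 3 * card ?X" using k3 by simp
    obtain m where m: "n = m + 8" using n8 by (metis le_add_diff_inverse2)
    have "(m + 6) * card S = m * card S + 6 * card S" by (simp add: algebra_simps)
    moreover have "m * 8 \<le> m * card S" using False by (intro mult_left_mono) auto
    moreover have "(m + 6) * card S \<le> 3 * card ?X" using 1 m by (simp add: add.commute)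
    ultimately show ?thesis using False m by linarith
  qed
  then show ?thesis using card_Diff_arcs[OF h finX, of f] by linarith
qed

lemma hall_7_4:
  assumes h: "ham_cycle V h" and nk: "n = 7" "k = 4"
    and S: "S \<subseteq> free_pairs h" "S \<noteq> {}"
  shows "card S \<le> card (\<Union>(containing ` S) - f ` h)"
proof -
  have finS: "finite S" using S finite_free_pairs finite_subset by blast
  let ?X = "\<Union>(containing ` S)"
  have finX: "finite ?X" using finS finite_containing by blast
  have N10: "N = 10" using nk by (simp add: choose_two)
  obtain p where p: "p \<in> S" using S by blast
  have "card (containing p) \<le> card ?X" using p finX by (intro card_mono) auto
  then have NX: "10 \<le> card ?X" using card_containing_free S(1) p N10 by auto
  have "card S + n \<le> card ?X"
  proof (cases "card S \<le> 3")
    case True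
    then show ?thesis using NX nk by linarith
  next
    case False
    then have "\<not> S \<subseteq> {p}" using card_mono[of "{p}" S] by auto
    then obtain p' where p': "p' \<in> S" "p' \<noteq> p" by blast
    have "card (containing p \<union> containing p') \<le> card ?X" using p p' finX by (intro card_mono) auto
    moreover have "16 \<le> card (containing p \<union> containing p')"
      using card_Un_containing[of p h p'] p p' S(1) N10 nk by auto
    \<comment> \<open>If \<open>card ?X < card S + 7\<close>, this would give
      \<open>4 * card ?X \<le> 60\<close>; the 16 = 2 * 10 - 4 hyperarcs on two pairs are just
      enough to exclude it.\<close>
    moreover have "10 * card S \<le> 6 * card ?X"
      using N_card_le[OF S(1)] N10 nk by (simp add: choose_two)
    ultimately show ?thesis using nk by linarith
  qed
  then show ?thesis using card_Diff_arcs[OF h finX, of f] by linarith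
qed

text \<open>Each representative \<open>f e\<close> is a triple containing the cycle arc \<open>e\<close>. Hence at most two free pairs lie
  in it, and if a free pair \<open>p\<close> does, then \<open>e\<close> is one of the at most four cycle arcs meeting \<open>p\<close>.\<close>

lemma hall_3:
  assumes h: "ham_cycle V h" and f: "\<And>e. e \<in> h \<Longrightarrow> f e \<in> gens e" and k: "k = 3"
    and S: "S \<subseteq> free_pairs h" "S \<noteq> {}"
  shows "card S \<le> card (\<Union>(containing ` S) - f ` h)"
proof -
  have finS: "finite S" using S finite_free_pairs finite_subset by blast
  let ?X = "\<Union>(containing ` S)"
  have finX: "finite ?X" using finS finite_containing by blast
  have N: "N = n - 2" using k by simp
  have c1: "card (containing p) = n - 2" if "p \<in> S" for p using card_containing_free S(1) N that by auto
  have c2: "card (containing p \<inter> containing p') \<le> 1" if "p \<in> S" "p' \<in> S" "p \<noteq> p'" for p p'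
    using card_containing_share[of p p'] that S(1) k unfolding free_pairs_def by auto
  have fA: "f e \<in> A" "{fst e, snd e} \<subseteq> set (f e)" if "e \<in> h" for e
    using f[OF that] precedes_in_set[of "fst e" "snd e" "f e"] unfolding gens_def by auto
  have "1 \<le> card S" using S(2) finS by (simp add: Suc_le_eq card_gt_0_iff)
  \<comment> \<open>Up to five pairs, inclusion-exclusion suffices: after subtracting
    \<open>n\<close> values of \<open>f\<close>, two pairs leave \<open>n - 5\<close> hyperarcs and
    three leave \<open>2 * n - 9\<close>, which is 5 at \<open>n = 7\<close>. A single pair would be
    left with nothing, so there only the values containing it are subtracted.\<close>
  then consider "card S = 1" | "card S = 2" | "3 \<le> card S" "card S \<le> 5" | "6 \<le> card S"
    by linarith
  then show ?thesis
  proof cases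
    case 1
    then obtain p where p: "S = {p}" by (metis card_1_singletonE)
    then have pf: "p \<in> free_pairs h" using S(1) by simp
    then obtain x z where xz: "p = {x, z}" "x \<noteq> z" "x \<in> V" "z \<in> V"
      unfolding free_pairs_def by (auto simp: card_2_iff)
    note su = ham_cycle_succ_unique[OF h] and pre = ham_cycle_pred_unique[OF h]
    obtain x1 x2 z1 z2 where e: "(x, x1) \<in> h" "(x2, x) \<in> h" "(z, z1) \<in> h" "(z2, z) \<in> h"
      using ham_cycle_succ[OF h] ham_cycle_pred[OF h] xz by meson
    have "containing p \<inter> f ` h \<subseteq> f ` {(x, x1), (x2, x), (z, z1), (z2, z)}"
    proof
      fix a assume "a \<in> containing p \<inter> f ` h"
      then obtain u v where uv: "(u, v) \<in> h" "a = f (u, v)" and pa: "p \<subseteq> set a"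
        unfolding containing_def by auto
      have "{u, v} \<inter> {x, z} \<noteq> {}"
      proof
        assume "{u, v} \<inter> {x, z} = {}"
        then have "card {u, v, x, z} = 4" using arc_facts(3)[OF h uv(1)] xz by (auto simp: card_insert_if)
        moreover have "card {u, v, x, z} \<le> card (set a)"
          using fA[OF uv(1)] uv(2) pa xz by (intro card_mono) auto
        ultimately show False using card_set[OF fA(1)[OF uv(1)]] uv(2) k by simp
      qed
      then have "(u, v) \<in> {(x, x1), (x2, x), (z, z1), (z2, z)}"
        using uv(1) e su pre by blast
      then show "a \<in> f ` {(x, x1), (x2, x), (z, z1), (z2, z)}" using uv(2) by blast
    qed
    then have "card (containing p \<inter> f ` h) \<le> card (f ` {(x, x1), (x2, x), (z, z1), (z2, z)})"
      by (intro card_mono) auto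
    also have "\<dots> \<le> card {(x, x1), (x2, x), (z, z1), (z2, z)}" by (rule card_image_le) simp
    also have "\<dots> \<le> 4" by (simp add: card_insert_if)
    finally have "card (containing p \<inter> f ` h) \<le> 4" .
    moreover have "card (containing p - f ` h) = card (containing p) - card (containing p \<inter> f ` h)"
      using finite_containing by (intro card_Diff_subset_Int) auto
    ultimately show ?thesis using c1[of p] p n7 1 by simp
  next
    case 2
    then obtain p q where pq: "S = {p, q}" "p \<noteq> q" by (metis card_2_iff)
    have "card (containing p) + card (containing q) = card (containing p \<union> containing q) + card (containing p \<inter> containing q)"
      by (rule card_Un_Int) (rule finite_containing)+
    then have "2 * n \<le> card ?X + 5" using c1 c2[of p q] pq n7 by simp
    then show ?thesis using card_Diff_arcs[OF h finX, of f] n7 2 by linarith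
  next
    case 3
    obtain S' where S': "S' \<subseteq> S" "card S' = 3" using obtain_subset_with_card_n[OF 3(1)] by metis
    then obtain p q r where pqr: "S' = {p, q, r}" "p \<noteq> q" "q \<noteq> r" "p \<noteq> r"
      by (metis card_3_iff)
    have in_S: "p \<in> S" "q \<in> S" "r \<in> S" using pqr S' by auto
    have "card (containing p) + card (containing q) = card (containing p \<union> containing q) + card (containing p \<inter> containing q)"
      by (rule card_Un_Int) (rule finite_containing)+
    moreover have "card (containing p \<union> containing q) + card (containing r)
        = card (containing p \<union> containing q \<union> containing r) + card ((containing p \<union> containing q) \<inter> containing r)"
      by (rule card_Un_Int) (use finite_containing in auto)
    moreover have "card ((containing p \<union> containing q) \<inter> containing r) \<le> card (containing p \<inter> containing r) + card (containing q \<inter> containing r)"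
      by (simp add: Int_Un_distrib2 card_Un_le)
    moreover have "card (containing p \<union> containing q \<union> containing r) \<le> card ?X"
      using in_S finX by (intro card_mono) auto
    moreover have "card (containing p \<inter> containing q) \<le> 1" "card (containing p \<inter> containing r) \<le> 1" "card (containing q \<inter> containing r) \<le> 1"
      using c2 in_S pqr by auto
    ultimately have "3 * (n - 2) \<le> card ?X + 3" using c1 in_S by simp
    then show ?thesis using card_Diff_arcs[OF h finX, of f] n7 3 by linarith
  next
    case 4
    let ?c = "\<lambda>a. card {p \<in> S. p \<subseteq> set a}"
    have XA: "a \<in> A" if "a \<in> ?X" for a using that unfolding containing_def by auto
    have "?c a \<le> 2" if a: "a \<in> f ` h" for a
    proof -
      obtain u v where uv: "(u, v) \<in> h" "a = f (u, v)" using a by auto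
      have aA: "a \<in> A" and sub: "{u, v} \<subseteq> set a" using fA[OF uv(1)] uv(2) by auto
      have "card {u, v} = 2" using arc_facts(3)[OF h uv(1)] by simp
      moreover have "{u, v} \<notin> S" using S(1) uv(1) unfolding free_pairs_def by auto
      ultimately have "{p \<in> S. p \<subseteq> set a} \<subseteq> {p. p \<subseteq> set a \<and> card p = 2} - {{u, v}}"
        using free_pairs_in_hyperarc[OF S(1) aA] by auto
      then have "?c a \<le> card ({p. p \<subseteq> set a \<and> card p = 2} - {{u, v}})"
        by (intro card_mono) auto
      also have "\<dots> = 2"
        using card_2_subsets[OF aA] k sub \<open>card {u, v} = 2\<close> by (simp add: choose_two)
      finally show ?thesis .
    qed
    then have "sum ?c (?X \<inter> f ` h) \<le> card (?X \<inter> f ` h) * 2"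
      using sum_bounded_above[of "?X \<inter> f ` h" ?c 2] by simp
    moreover have "card (?X \<inter> f ` h) \<le> n"
      using card_image_le[OF finite_arcs[OF h], of f] card_mono[of "f ` h" "?X \<inter> f ` h"]
        finite_arcs[OF h] card_arcs[OF h] by simp
    moreover have "sum ?c (?X - f ` h) \<le> card (?X - f ` h) * 3"
      using sum_bounded_above[of "?X - f ` h" ?c 3] card_free_pairs_in_hyperarc[OF S(1)] XA k
      by (simp add: choose_two)
    moreover have "(n - 2) * card S = sum ?c (?X \<inter> f ` h) + sum ?c (?X - f ` h)"
      using containing_double_count[OF S(1)] N sum.Int_Diff[OF finX, of ?c "f ` h"] by simp
    ultimately have 1: "(n - 2) * card S \<le> 3 * card (?X - f ` h) + 2 * n" by linarith
    obtain m where m: "n = m + 7" using n7 by (metis le_add_diff_inverse2)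
    have "(m + 5) * card S = m * card S + 5 * card S" by (simp add: algebra_simps)
    moreover have "m * 6 \<le> m * card S" using 4 by (intro mult_left_mono) auto
    moreover have "(m + 5) * card S \<le> 3 * card (?X - f ` h) + 2 * n" using 1 m by (simp add: add.commute)
    ultimately show ?thesis using 4 m by linarith
  qed
qed

theorem strong_tournament_generated:
  assumes "strong_hyper V A"
  shows "\<exists>T \<in> gen_tournaments V A. strong_tournament V T"
proof -
  obtain h f where h: "ham_cycle V h" and f: "inj_on f h" "\<And>e. e \<in> h \<Longrightarrow> f e \<in> gens e"
    using rainbow_ham_cycle[OF assms] unfolding sdr_def by blast
  show ?thesis
  proof (rule extend_rainbow[OF h f])
    fix S assume S: "S \<subseteq> free_pairs h" "S \<noteq> {}"
    consider "k = 3" | "4 \<le> k" "8 \<le> n" | "n = 7" "k = 4" using k3 kn n7 by linarith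
    then show "card S \<le> card (\<Union>(containing ` S) - f ` h)"
      using hall_3[OF h f(2) _ S] hall_large[OF h _ _ S] hall_7_4[OF h _ _ S] by cases blast+
  qed
qed

end

theorem theorem4:
  fixes V :: "'a set" and A :: "'a list set" and n k :: nat
  assumes "finite V" and "card V = n"
    and "7 \<le> n" and "3 \<le> k" and "k \<le> n - 3"
    and "k_tournament V A k" and "strong_hyper V A"
  shows "\<exists>T \<in> gen_tournaments V A. strong_tournament V T"
proof -
  interpret hypertournament V A n k by unfold_locales (use assms in auto)
  show ?thesis by (rule strong_tournament_generated) (rule assms)
qed

end
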